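(* Let $\mathcal{A}$ be a Fréchet algebra with unit. The map $$(t,q,P,L(0))\in\mathbb{R}^2\times C^\infty(\mathbb{R},\mathcal{A})\times\mathcal{A}\ \longmapsto\ L_q(t)\in\mathcal{A}[[q]]$$ is smooth, where $L_q$ is the unique solution in $\mathcal{A}[[q]]$ of $\partial_tL_q(t)=[P_q(t),L_q(t)]$, $L_q(0)=L(0)$.
   Context: For a smooth path $P:\mathbb{R}\to\mathcal{A}$ and $q\in\mathbb{R}$, $P_q(t)=qP(qt)$; following the paper's convention it is regarded as a degree-one monomial in the formal variable $q$ of $\mathcal{A}[[q]]$, with coefficient $P(qt)\in\mathcal{A}$ for the given value of the scaling parameter. The solution is $L_q(t)=\exp(P_q)(t)\,L(0)\,(\exp(P_q)(t))^{-1}$ with $$\exp(P_q)(t)=\sum_{i=0}^\infty\int_{t\ge s_1\ge\dots\ge s_i\ge0}P_q(s_1)\cdots P_q(s_i)\,ds_1\cdots ds_i .$$ For $t<0$ the iterated integrals are the usual oriented ones. Smoothness is in the sense of Frölicher spaces (smooth curves are mapped to smooth curves); the Frölicher structure on $\mathcal{A}[[q]]$ is the one generated by smoothness of each coefficient, and $C^\infty(\mathbb{R},\mathcal{A})$ carries its usual Fréchet (hence Frölicher) structure. *)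

theory Defs
  imports "HOL-Analysis.Analysis" "HOL-Computational_Algebra.Formal_Power_Series"
begin

definition (in real_vector) seminorm :: "('a \<Rightarrow> real) \<Rightarrow> bool" where
  "seminorm p \<longleftrightarrow>
     (\<forall>x y. p (x + y) \<le> p x + p y) \<and> (\<forall>r x. p (r *\<^sub>R x) = \<bar>r\<bar> * p x)"

class t2_real_vector = real_vector + t2_space

(* A countable family of seminorms that induces the topology and for which Cauchy sequences
   converge. The family is not assumed to be increasing, so basic neighbourhoods use finitely
   many seminorms. *)
definition (in t2_real_vector) frechet_seminorms :: "(nat \<Rightarrow> 'a \<Rightarrow> real) \<Rightarrow> bool" where
  "frechet_seminorms p \<longleftrightarrow>
     (\<forall>n. seminorm (p n)) \<and>
     (\<forall>U. open U \<longleftrightarrow>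
        (\<forall>x\<in>U. \<exists>N. \<exists>e>0. \<forall>y. (\<forall>n\<le>N. p n (y - x) < e) \<longrightarrow> y \<in> U)) \<and>
     (\<forall>X :: nat \<Rightarrow> 'a.
        (\<forall>n. \<forall>e>0. \<exists>M. \<forall>i\<ge>M. \<forall>j\<ge>M. p n (X i - X j) < e) \<longrightarrow> (\<exists>x. X \<longlonglongrightarrow> x))"

(* The family separates points because the topology is Hausdorff. *)
class frechet_space = t2_real_vector +
  assumes frechet_seminorms_exist: "\<exists>p. frechet_seminorms p"

(* Multiplication is jointly continuous; submultiplicativity of the seminorms is not required.
   Using monoid_mult instead of ring_1 for the unit does not exclude the zero algebra. *)
class frechet_algebra_1 = frechet_space + real_algebra + topological_monoid_mult

definition has_curve_derivative ::
    "(real \<Rightarrow> 'v::{real_vector, topological_space}) \<Rightarrow> 'v \<Rightarrow> real \<Rightarrow> bool" where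
  "has_curve_derivative c v t \<longleftrightarrow> ((\<lambda>h. (c (t + h) - c t) /\<^sub>R h) \<longlongrightarrow> v) (at 0)"

definition smooth_curve :: "(real \<Rightarrow> 'v::{real_vector, topological_space}) \<Rightarrow> bool" where
  "smooth_curve c \<longleftrightarrow>
     (\<exists>D :: nat \<Rightarrow> real \<Rightarrow> 'v.
        D 0 = c \<and> (\<forall>k t. has_curve_derivative (D k) (D (Suc k) t) t))"

(* A meaningful value only where the derivative exists. *)
definition curve_deriv :: "(real \<Rightarrow> 'v::{real_vector, t2_space}) \<Rightarrow> real \<Rightarrow> 'v" where
  "curve_deriv c t = Lim (at 0) (\<lambda>h. (c (t + h) - c t) /\<^sub>R h)"

lemma seminorm_triangle: "seminorm p \<Longrightarrow> p (x + y) \<le> p x + p y"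
  and seminorm_scaleR: "seminorm p \<Longrightarrow> p (r *\<^sub>R x) = \<bar>r\<bar> * p x"
  by (simp_all add: seminorm_def)

lemma seminorm_zero: "seminorm p \<Longrightarrow> p 0 = 0"
  using seminorm_scaleR[of p 0 0] by simp

lemma seminorm_nonneg: "seminorm p \<Longrightarrow> 0 \<le> p x"
  using seminorm_triangle[of p x "- x"] seminorm_scaleR[of p "-1" x] seminorm_zero[of p] by simp

lemma tendsto_seminorms_iff:
  fixes p :: "nat \<Rightarrow> 'a::frechet_space \<Rightarrow> real"
  assumes "frechet_seminorms p"
  shows "(f \<longlongrightarrow> l) F \<longleftrightarrow> (\<forall>n. ((\<lambda>x. p n (f x - l)) \<longlongrightarrow> 0) F)"
proof -
  have p: "\<And>n. seminorm (p n)"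
    and op: "\<And>U. open U \<longleftrightarrow>
           (\<forall>x\<in>U. \<exists>N. \<exists>e>0. \<forall>y. (\<forall>n\<le>N. p n (y - x) < e) \<longrightarrow> y \<in> U)"
    using assms by (simp_all only: frechet_seminorms_def)
  show ?thesis
  proof
    assume L: "(f \<longlongrightarrow> l) F"
    show "\<forall>n. ((\<lambda>x. p n (f x - l)) \<longlongrightarrow> 0) F"
    proof (intro allI tendstoI)
      fix n and e :: real assume e: "e > 0"
      have "open {y. p n (y - l) < e}"
        unfolding op
      proof (intro ballI)
        fix x assume x: "x \<in> {y. p n (y - l) < e}"
        have "p n (y - l) < e" if "p n (y - x) < e - p n (x - l)" for y
        proof -
          have "p n ((y - x) + (x - l)) \<le> p n (y - x) + p n (x - l)"
            using p by (rule seminorm_triangle)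
          then show ?thesis using that by simp
        qed
        then show "\<exists>N. \<exists>d>0. \<forall>y. (\<forall>m\<le>N. p m (y - x) < d) \<longrightarrow> y \<in> {y. p n (y - l) < e}"
          using x by (intro exI[of _ n] exI[of _ "e - p n (x - l)"]) auto
      qed
      moreover have "l \<in> {y. p n (y - l) < e}" using e seminorm_zero[OF p] by simp
      ultimately have "\<forall>\<^sub>F x in F. f x \<in> {y. p n (y - l) < e}"
        using L by (rule topological_tendstoD[rotated])
      then show "\<forall>\<^sub>F x in F. dist (p n (f x - l)) 0 < e"
        by eventually_elim (use seminorm_nonneg[OF p] in \<open>simp add: dist_real_def\<close>)
    qed
  next
    assume R: "\<forall>n. ((\<lambda>x. p n (f x - l)) \<longlongrightarrow> 0) F"
    show "(f \<longlongrightarrow> l) F"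
    proof (rule topological_tendstoI)
      fix U assume "open U" "l \<in> U"
      then obtain N e where e: "e > 0" and U: "\<And>y. (\<forall>n\<le>N. p n (y - l) < e) \<Longrightarrow> y \<in> U"
        unfolding op by blast
      have "\<forall>\<^sub>F x in F. \<forall>n\<in>{..N}. p n (f x - l) < e"
        using R e by (intro eventually_ball_finite ballI) (auto intro: order_tendstoD(2))
      then show "\<forall>\<^sub>F x in F. f x \<in> U"
        by eventually_elim (auto intro: U)
    qed
  qed
qed

lemma frechet_tendsto_add:
  fixes f g :: "_ \<Rightarrow> 'a::frechet_space"
  assumes "(f \<longlongrightarrow> a) F" "(g \<longlongrightarrow> b) F"
  shows "((\<lambda>x. f x + g x) \<longlongrightarrow> a + b) F"
proof -
  obtain p :: "nat \<Rightarrow> 'a \<Rightarrow> real" where fp: "frechet_seminorms p"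
    using frechet_seminorms_exist by blast
  have p: "\<And>n. seminorm (p n)"
    using fp by (simp add: frechet_seminorms_def)
  note iff = tendsto_seminorms_iff[OF fp]
  show ?thesis unfolding iff
  proof
    fix n
    have "((\<lambda>x. p n (f x - a) + p n (g x - b)) \<longlongrightarrow> 0 + 0) F"
      using assms unfolding iff by (intro tendsto_add) auto
    then have "((\<lambda>x. p n (f x - a) + p n (g x - b)) \<longlongrightarrow> 0) F" by simp
    moreover have "norm (p n (f x + g x - (a + b))) \<le> p n (f x - a) + p n (g x - b)" for x
    proof -
      have "p n (f x + g x - (a + b)) \<le> p n (f x - a) + p n (g x - b)"
        unfolding add_diff_add using p by (rule seminorm_triangle)
      then show ?thesis
        using seminorm_nonneg[OF p] by simp
    qed
    ultimately show "((\<lambda>x. p n (f x + g x - (a + b))) \<longlongrightarrow> 0) F"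
      by (metis (no_types, lifting) Lim_null_comparison always_eventually)
  qed
qed

lemma frechet_tendsto_scaleR:
  fixes f :: "_ \<Rightarrow> 'a::frechet_space"
  assumes "(f \<longlongrightarrow> a) F"
  shows "((\<lambda>x. r *\<^sub>R f x) \<longlongrightarrow> r *\<^sub>R a) F"
proof -
  obtain p :: "nat \<Rightarrow> 'a \<Rightarrow> real" where fp: "frechet_seminorms p"
    using frechet_seminorms_exist by blast
  have p: "\<And>n. seminorm (p n)"
    using fp by (simp add: frechet_seminorms_def)
  note iff = tendsto_seminorms_iff[OF fp]
  have eq: "p n (r *\<^sub>R f x - r *\<^sub>R a) = \<bar>r\<bar> * p n (f x - a)" for n x
    using seminorm_scaleR[OF p] by (simp add: scaleR_diff_right[symmetric])
  show ?thesis
    using assms unfolding iff eq by (auto intro: tendsto_mult_right_zero)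
qed

lemma smooth_curve_const: "smooth_curve (\<lambda>_. v)"
  unfolding smooth_curve_def has_curve_derivative_def
  by (rule exI[of _ "\<lambda>k _. if k = 0 then v else 0"]) auto

lemma smooth_curve_add:
  fixes c d :: "real \<Rightarrow> 'a::frechet_space"
  assumes "smooth_curve c" "smooth_curve d"
  shows "smooth_curve (\<lambda>t. c t + d t)"
proof -
  obtain C D where C: "C 0 = c" "\<And>k t. has_curve_derivative (C k) (C (Suc k) t) t"
    and D: "D 0 = d" "\<And>k t. has_curve_derivative (D k) (D (Suc k) t) t"
    using assms unfolding smooth_curve_def by blast
  have eq: "(C k (t + h) + D k (t + h) - (C k t + D k t)) /\<^sub>R h =
      (C k (t + h) - C k t) /\<^sub>R h + (D k (t + h) - D k t) /\<^sub>R h" for k t h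
    by (simp add: add_diff_add scaleR_add_right)
  have "has_curve_derivative (\<lambda>t. C k t + D k t) (C (Suc k) t + D (Suc k) t) t" for k t
    unfolding has_curve_derivative_def eq
    using C(2) D(2) by (intro frechet_tendsto_add) (simp_all add: has_curve_derivative_def)
  then show ?thesis
    unfolding smooth_curve_def
    by (intro exI[of _ "\<lambda>k t. C k t + D k t"]) (simp add: C(1) D(1))
qed

lemma smooth_curve_scaleR:
  fixes c :: "real \<Rightarrow> 'a::frechet_space"
  assumes "smooth_curve c"
  shows "smooth_curve (\<lambda>t. r *\<^sub>R c t)"
proof -
  obtain C where C: "C 0 = c" "\<And>k t. has_curve_derivative (C k) (C (Suc k) t) t"
    using assms unfolding smooth_curve_def by blast
  have eq: "(r *\<^sub>R C k (t + h) - r *\<^sub>R C k t) /\<^sub>R h = r *\<^sub>R ((C k (t + h) - C k t) /\<^sub>R h)"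
    for k t h
    by (simp add: scaleR_diff_right mult.commute)
  have "has_curve_derivative (\<lambda>t. r *\<^sub>R C k t) (r *\<^sub>R C (Suc k) t) t" for k t
    unfolding has_curve_derivative_def eq
    using C(2) by (intro frechet_tendsto_scaleR) (simp add: has_curve_derivative_def)
  then show ?thesis
    unfolding smooth_curve_def
    by (intro exI[of _ "\<lambda>k t. r *\<^sub>R C k t"]) (simp add: C(1))
qed

typedef (overloaded) 'a smooth_path = "{f :: real \<Rightarrow> 'a::frechet_space. smooth_curve f}"
  morphisms path_at Abs_smooth_path
  using smooth_curve_const by blast

setup_lifting type_definition_smooth_path

instantiation smooth_path :: (frechet_space) real_vector
begin

lift_definition zero_smooth_path :: "'a smooth_path" is "\<lambda>_. 0"
  by (rule smooth_curve_const)

lift_definition plus_smooth_path :: "'a smooth_path \<Rightarrow> 'a smooth_path \<Rightarrow> 'a smooth_path"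
  is "\<lambda>f g t. f t + g t"
  by (rule smooth_curve_add)

lift_definition scaleR_smooth_path :: "real \<Rightarrow> 'a smooth_path \<Rightarrow> 'a smooth_path"
  is "\<lambda>r f t. r *\<^sub>R f t"
  by (rule smooth_curve_scaleR)

lift_definition uminus_smooth_path :: "'a smooth_path \<Rightarrow> 'a smooth_path"
  is "\<lambda>f t. - f t"
  using smooth_curve_scaleR[of _ "-1"] by simp

lift_definition minus_smooth_path :: "'a smooth_path \<Rightarrow> 'a smooth_path \<Rightarrow> 'a smooth_path"
  is "\<lambda>f g t. f t - g t"
  using smooth_curve_add[OF _ smooth_curve_scaleR[of _ "-1"]] by simp

instance
  by standard (transfer; simp add: fun_eq_iff algebra_simps)+

end

definition path_nhd ::
    "'a::frechet_space smooth_path \<Rightarrow> 'a set \<Rightarrow> nat \<Rightarrow> real \<Rightarrow> 'a smooth_path set" where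
  "path_nhd f V n r =
     {g. \<forall>k\<le>n. \<forall>t\<in>{-r..r}.
           (curve_deriv ^^ k) (path_at g) t - (curve_deriv ^^ k) (path_at f) t \<in> V}"

lemma path_nhd_Int: "path_nhd f (V \<inter> W) (max n m) (max r s) \<subseteq> path_nhd f V n r \<inter> path_nhd f W m s"
proof -
  have "k \<le> max n m" if "k \<le> n \<or> k \<le> m" for k using that by auto
  moreover have "t \<in> {- max r s..max r s}" if "t \<in> {-r..r} \<or> t \<in> {-s..s}" for t
    using that by auto
  ultimately show ?thesis unfolding path_nhd_def by blast
qed

(* The topology of uniform convergence of all derivatives on compact intervals. *)
instantiation smooth_path :: (frechet_space) topological_space
begin

definition open_smooth_path :: "'a smooth_path set \<Rightarrow> bool" where
  "open_smooth_path U \<longleftrightarrow>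
     (\<forall>f\<in>U. \<exists>V n r. open V \<and> 0 \<in> V \<and> path_nhd f V n r \<subseteq> U)"

instance
proof
  show "open (UNIV :: 'a smooth_path set)"
    unfolding open_smooth_path_def by (auto intro!: exI[of _ UNIV])
next
  fix S T :: "'a smooth_path set"
  assume S: "open S" and T: "open T"
  show "open (S \<inter> T)"
    unfolding open_smooth_path_def
  proof
    fix f assume f: "f \<in> S \<inter> T"
    obtain V n r where V: "open V" "0 \<in> V" "path_nhd f V n r \<subseteq> S"
      using S f unfolding open_smooth_path_def by blast
    obtain W m s where W: "open W" "0 \<in> W" "path_nhd f W m s \<subseteq> T"
      using T f unfolding open_smooth_path_def by blast
    have "open (V \<inter> W)" "0 \<in> V \<inter> W" using V W by auto
    moreover have "path_nhd f (V \<inter> W) (max n m) (max r s) \<subseteq> S \<inter> T"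
      using path_nhd_Int[of f V W n m r s] V(3) W(3) by blast
    ultimately show "\<exists>V n r. open V \<and> 0 \<in> V \<and> path_nhd f V n r \<subseteq> S \<inter> T"
      by blast
  qed
next
  fix K :: "'a smooth_path set set"
  assume "\<forall>S\<in>K. open S"
  then show "open (\<Union>K)"
    unfolding open_smooth_path_def by (meson Union_iff Union_upper subset_trans)
qed

end

(* A Froelicher structure is determined by its set of smooth curves (its functions are the
   real-valued maps that are smooth along these curves), so only the curves are recorded. *)
definition frolicher_smooth ::
    "(real \<Rightarrow> 'x) set \<Rightarrow> (real \<Rightarrow> 'y) set \<Rightarrow> ('x \<Rightarrow> 'y) \<Rightarrow> bool" where
  "frolicher_smooth C D f \<longleftrightarrow> (\<forall>c\<in>C. f \<circ> c \<in> D)"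

definition frechet_curves :: "(real \<Rightarrow> 'v::{real_vector, topological_space}) set" where
  "frechet_curves = {c. smooth_curve c}"

(* The initial structure for the coefficient maps; the library's metric topology on formal
   power series plays no role. *)
definition fps_curves :: "(real \<Rightarrow> 'a::frechet_algebra_1 fps) set" where
  "fps_curves = {c. \<forall>n. (\<lambda>s. fps_nth (c s) n) \<in> frechet_curves}"

definition has_fps_derivative ::
    "(real \<Rightarrow> 'a::frechet_algebra_1 fps) \<Rightarrow> 'a fps \<Rightarrow> real \<Rightarrow> bool" where
  "has_fps_derivative L M t \<longleftrightarrow>
     (\<forall>n. has_curve_derivative (\<lambda>s. fps_nth (L s) n) (fps_nth M n) t)"

(* The monomial q P(q t): the explicit factor is the formal variable, whereas the scaling
   inside the argument uses the real value of q. *)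
definition scaled_path :: "real \<Rightarrow> 'a::frechet_algebra_1 smooth_path \<Rightarrow> real \<Rightarrow> 'a fps" where
  "scaled_path q P t = fps_X * fps_const (path_at P (q * t))"

definition lax_solution ::
    "real \<Rightarrow> 'a::frechet_algebra_1 smooth_path \<Rightarrow> 'a \<Rightarrow> (real \<Rightarrow> 'a fps) \<Rightarrow> bool" where
  "lax_solution q P a L \<longleftrightarrow>
     L 0 = fps_const a \<and>
     (\<forall>t. has_fps_derivative L (scaled_path q P t * L t - L t * scaled_path q P t) t)"

end

theory Submission
  imports Defs
begin

text \<open>
The equation is triangular in powers of the formal variable: the coefficient of degree \<open>0\<close> does
not depend on time, and the coefficient of degree \<open>n + 1\<close> is the primitive, vanishing at time
\<open>0\<close>, of the commutator of \<open>P(q t)\<close> with the coefficient of degree \<open>n\<close>. Iterated integration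
therefore gives a solution (\<open>lax_coeff\<close>), and it is the only one because a curve with derivative
\<open>0\<close> is constant; this is \<open>lax_solution_iff\<close>.

For smoothness, let \<open>t\<close>, \<open>q\<close>, \<open>P\<close> and \<open>a\<close> be smooth curves of data in a common parameter \<open>s\<close>.
The claim proved by induction on \<open>n\<close> is that the coefficient of degree \<open>n\<close>, taken at time \<open>t\<close> for
the data belonging to \<open>s\<close>, is a smooth function of the two real variables \<open>t\<close> and \<open>s\<close>
(\<open>smooth2_lax_coeff\<close>). Substituting \<open>t = t(s)\<close> then gives a smooth curve. The induction needs
that smooth functions of two variables are stable under continuous bilinear maps
(\<open>Ck_bilinear\<close>), substitution (\<open>Ck_compose\<close>) and the formation of primitives in the first variable
(\<open>Ck_primitive\<close>), and that a smooth curve of paths is jointly smooth in the time and the parameter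
(\<open>smooth2_path_eval\<close>, one half of the exponential law). Constant curves of data are
smooth, so the same induction also supplies the differentiability of the iterated integrals.

The calculus behind these facts rests on an integral over the unit interval only, the limit of
Riemann sums. It depends continuously on parameters, and by the fundamental theorem
\<open>c (x + h) - c x\<close> is \<open>h\<close> times the integral of \<open>c' (x + \<theta> * h)\<close> over \<open>\<theta> \<in> [0, 1]\<close>. Difference
quotients are thereby integrals that still make sense and are continuous at \<open>h = 0\<close>, so derivatives
can be read off by setting \<open>h = 0\<close>, and no remainder has to be estimated.
\<close>

section \<open>Frechet spaces through continuous seminorms\<close>

text \<open>Makes the limit and continuity rules of the library for sums and differences available.\<close>

instance frechet_space \<subseteq> topological_ab_group_add
proof
  fix a b :: 'a
  show "((\<lambda>x. fst x + snd x) \<longlongrightarrow> a + b) (nhds a \<times>\<^sub>F nhds b)"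
    by (intro frechet_tendsto_add filterlim_fst filterlim_snd)
  show "(uminus \<longlongrightarrow> - a) (nhds a)"
    using frechet_tendsto_scaleR[of "\<lambda>x. x" a "nhds a" "-1"] by (simp add: filterlim_ident)
qed

lemma null_comparison:
  fixes f :: "'a \<Rightarrow> 'b::real_normed_vector"
  assumes "(g \<longlongrightarrow> 0) F" "\<And>x. norm (f x) \<le> g x"
  shows "(f \<longlongrightarrow> 0) F"
  by (rule Lim_null_comparison[OF always_eventually]) (use assms in auto)

text \<open>Arguments with all continuous seminorms do not depend on the choice of a defining
family, and the lemmas below make it possible to forget that family altogether.\<close>

definition cont_seminorm :: "('a::{real_vector, topological_space} \<Rightarrow> real) \<Rightarrow> bool" where
  "cont_seminorm p \<longleftrightarrow> seminorm p \<and> continuous_on UNIV p"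

lemma cont_seminorm_diff_triangle:
  assumes "cont_seminorm p"
  shows "p (x - z) \<le> p (x - y) + p (y - z)"
  using assms seminorm_triangle[of p "x - y" "y - z"] by (simp add: cont_seminorm_def)

lemma cont_seminorm_triangle: "cont_seminorm p \<Longrightarrow> p (x + y) \<le> p x + p y"
  and cont_seminorm_scaleR: "cont_seminorm p \<Longrightarrow> p (r *\<^sub>R x) = \<bar>r\<bar> * p x"
  and cont_seminorm_zero: "cont_seminorm p \<Longrightarrow> p 0 = 0"
  and cont_seminorm_nonneg: "cont_seminorm p \<Longrightarrow> 0 \<le> p x"
  by (simp_all add: cont_seminorm_def seminorm_triangle seminorm_scaleR seminorm_zero
      seminorm_nonneg)

lemma cont_seminorm_minus: "cont_seminorm p \<Longrightarrow> p (- x) = p x"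
  using cont_seminorm_scaleR[of p "-1" x] by simp

lemma cont_seminorm_commute: "cont_seminorm p \<Longrightarrow> p (x - y) = p (y - x)"
  using cont_seminorm_minus[of p "x - y"] by simp

lemma cont_seminorm_triangle_diff: "cont_seminorm p \<Longrightarrow> p (x - y) \<le> p x + p y"
  using cont_seminorm_triangle[of p x "- y"] by (simp add: cont_seminorm_minus)

lemma cont_seminorm_sum:
  assumes "cont_seminorm p"
  shows "p (\<Sum>i\<in>A. f i) \<le> (\<Sum>i\<in>A. p (f i))"
  by (induction A rule: infinite_finite_induct)
     (auto simp: cont_seminorm_zero[OF assms]
       intro: order_trans[OF cont_seminorm_triangle[OF assms]])

lemma cont_seminorm_continuous_on:
  fixes f :: "'b::topological_space \<Rightarrow> 'a::{real_vector, topological_space}"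
  assumes "cont_seminorm p" "continuous_on S f"
  shows "continuous_on S (\<lambda>x. p (f x))"
  using assms continuous_on_compose2[of UNIV p S f] by (auto simp: cont_seminorm_def)

text \<open>A member of the family is continuous by the reverse triangle inequality.\<close>

lemma frechet_seminorms_cont:
  fixes p :: "nat \<Rightarrow> 'a::frechet_space \<Rightarrow> real"
  assumes "frechet_seminorms p"
  shows "cont_seminorm (p n)"
proof -
  have p: "seminorm (p n)"
    using assms by (simp add: frechet_seminorms_def)
  have "(p n \<longlongrightarrow> p n x) (at x)" for x
  proof -
    have "((\<lambda>y. y) \<longlongrightarrow> x) (at x)" by (rule tendsto_ident_at)
    then have "((\<lambda>y. p n (y - x)) \<longlongrightarrow> 0) (at x)"
      unfolding tendsto_seminorms_iff[OF assms] by blast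
    moreover have "norm (p n y - p n x) \<le> p n (y - x)" for y
    proof -
      have "p n x \<le> p n (x - y) + p n y" "p n y \<le> p n (y - x) + p n x"
        using seminorm_triangle[OF p, of "x - y" y] seminorm_triangle[OF p, of "y - x" x] by auto
      moreover have "p n (x - y) = p n (y - x)"
        using seminorm_scaleR[OF p, of "-1" "x - y"] by simp
      ultimately show ?thesis by auto
    qed
    ultimately have "((\<lambda>y. p n y - p n x) \<longlongrightarrow> 0) (at x)"
      by (rule null_comparison)
    then show ?thesis by (simp add: LIM_zero_iff)
  qed
  then show ?thesis
    using p by (simp add: cont_seminorm_def continuous_on_def)
qed

lemma frechet_tendstoI:
  fixes f :: "_ \<Rightarrow> 'a::frechet_space"
  assumes "\<And>p. cont_seminorm p \<Longrightarrow> ((\<lambda>x. p (f x - l)) \<longlongrightarrow> 0) F"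
  shows "(f \<longlongrightarrow> l) F"
proof -
  obtain p :: "nat \<Rightarrow> 'a \<Rightarrow> real" where p: "frechet_seminorms p"
    using frechet_seminorms_exist by blast
  show ?thesis
    unfolding tendsto_seminorms_iff[OF p] using assms frechet_seminorms_cont[OF p] by blast
qed

lemma frechet_tendstoI_less:
  fixes f :: "_ \<Rightarrow> 'a::frechet_space"
  assumes "\<And>p e. cont_seminorm p \<Longrightarrow> e > 0 \<Longrightarrow> \<forall>\<^sub>F x in F. p (f x - l) < e"
  shows "(f \<longlongrightarrow> l) F"
  by (intro frechet_tendstoI tendstoI) (simp add: assms cont_seminorm_nonneg)

lemma frechet_tendstoD:
  fixes f :: "_ \<Rightarrow> 'a::frechet_space"
  assumes "cont_seminorm p" "(f \<longlongrightarrow> l) F"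
  shows "((\<lambda>x. p (f x - l)) \<longlongrightarrow> 0) F"
proof -
  have "isCont p 0"
    using assms(1) by (simp add: cont_seminorm_def continuous_on_eq_continuous_at)
  moreover have "((\<lambda>x. f x - l) \<longlongrightarrow> 0) F"
    using tendsto_diff[OF assms(2) tendsto_const[of l]] by simp
  ultimately show ?thesis
    using isCont_tendsto_compose[of 0 p] by (simp add: cont_seminorm_zero[OF assms(1)])
qed

lemma frechet_tendstoD_less:
  fixes f :: "_ \<Rightarrow> 'a::frechet_space"
  assumes "cont_seminorm p" "(f \<longlongrightarrow> l) F" "e > 0"
  shows "\<forall>\<^sub>F x in F. p (f x - l) < e"
  using order_tendstoD(2)[OF frechet_tendstoD[OF assms(1,2)] assms(3)] .

lemma frechet_Cauchy_convergent:
  fixes X :: "nat \<Rightarrow> 'a::frechet_space"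
  assumes "\<And>p e. cont_seminorm p \<Longrightarrow> e > 0 \<Longrightarrow> \<exists>M. \<forall>i\<ge>M. \<forall>j\<ge>M. p (X i - X j) < e"
  shows "convergent X"
proof -
  obtain p :: "nat \<Rightarrow> 'a \<Rightarrow> real" where p: "frechet_seminorms p"
    using frechet_seminorms_exist by blast
  have "\<forall>n. \<forall>e>0. \<exists>M. \<forall>i\<ge>M. \<forall>j\<ge>M. p n (X i - X j) < e"
    using assms frechet_seminorms_cont[OF p] by blast
  then show ?thesis
    using p unfolding frechet_seminorms_def convergent_def by blast
qed

lemma frechet_tendsto_scaleR_joint:
  fixes f :: "_ \<Rightarrow> 'a::frechet_space"
  assumes r: "(r \<longlongrightarrow> a) F" and f: "(f \<longlongrightarrow> x) F"
  shows "((\<lambda>y. r y *\<^sub>R f y) \<longlongrightarrow> a *\<^sub>R x) F"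
proof (rule frechet_tendstoI)
  fix p :: "'a \<Rightarrow> real" assume p: "cont_seminorm p"
  have "isCont p x"
    using p by (simp add: cont_seminorm_def continuous_on_eq_continuous_at)
  then have pf: "((\<lambda>y. p (f y)) \<longlongrightarrow> p x) F"
    using f by (rule isCont_tendsto_compose)
  have "((\<lambda>y. \<bar>r y - a\<bar> * p (f y) + \<bar>a\<bar> * p (f y - x)) \<longlongrightarrow> \<bar>a - a\<bar> * p x + \<bar>a\<bar> * 0) F"
    by (intro tendsto_intros r pf frechet_tendstoD[OF p f])
  then have "((\<lambda>y. \<bar>r y - a\<bar> * p (f y) + \<bar>a\<bar> * p (f y - x)) \<longlongrightarrow> 0) F" by simp
  moreover have "norm (p (r y *\<^sub>R f y - a *\<^sub>R x)) \<le> \<bar>r y - a\<bar> * p (f y) + \<bar>a\<bar> * p (f y - x)" for y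
  proof -
    have "r y *\<^sub>R f y - a *\<^sub>R x = (r y - a) *\<^sub>R f y + a *\<^sub>R (f y - x)"
      by (simp add: algebra_simps)
    then show ?thesis
      using cont_seminorm_triangle[OF p, of "(r y - a) *\<^sub>R f y" "a *\<^sub>R (f y - x)"]
      by (simp only: cont_seminorm_scaleR[OF p] real_norm_def abs_of_nonneg[OF cont_seminorm_nonneg[OF p]])
  qed
  ultimately show "((\<lambda>y. p (r y *\<^sub>R f y - a *\<^sub>R x)) \<longlongrightarrow> 0) F"
    by (rule null_comparison)
qed

lemma frechet_continuous_on_scaleR:
  fixes f :: "'b::topological_space \<Rightarrow> 'a::frechet_space"
  assumes "continuous_on S r" "continuous_on S f"
  shows "continuous_on S (\<lambda>y. r y *\<^sub>R f y)"
  using assms unfolding continuous_on_def by (auto intro: frechet_tendsto_scaleR_joint)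

text \<open>The real line is a Frechet space, so that scalar functions and curves are covered by
the same calculus as vector-valued ones.\<close>

instance real :: t2_real_vector ..

instance real :: frechet_space
proof
  have "seminorm (abs :: real \<Rightarrow> real)"
    unfolding seminorm_def by (auto simp: abs_mult)
  moreover have "open U \<longleftrightarrow> (\<forall>x\<in>U. \<exists>N::nat. \<exists>e>0. \<forall>y. (\<forall>n\<le>N. \<bar>y - x\<bar> < e) \<longrightarrow> y \<in> U)"
    for U :: "real set"
  proof -
    have "(\<exists>N::nat. \<exists>e>0. \<forall>y. (\<forall>n\<le>N. \<bar>y - x\<bar> < e) \<longrightarrow> y \<in> U) \<longleftrightarrow>
        (\<exists>e>0. \<forall>y. \<bar>y - x\<bar> < e \<longrightarrow> y \<in> U)" for x
      by (meson le0)
    then show ?thesis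
      unfolding open_dist dist_real_def by simp
  qed
  moreover have "\<exists>x. X \<longlonglongrightarrow> x" if "\<forall>e>0. \<exists>M. \<forall>i\<ge>M. \<forall>j\<ge>M. \<bar>X i - X j\<bar> < e" for X :: "nat \<Rightarrow> real"
    using that Cauchy_convergent[of X] unfolding Cauchy_def dist_real_def convergent_def by blast
  ultimately show "\<exists>p :: nat \<Rightarrow> real \<Rightarrow> real. frechet_seminorms p"
    unfolding frechet_seminorms_def by (intro exI[of _ "\<lambda>_. abs"]) auto
qed

section \<open>Derivatives of curves\<close>

lemma has_curve_derivative_tendsto:
  fixes c :: "real \<Rightarrow> 'a::frechet_space"
  assumes "has_curve_derivative c v t"
  shows "((\<lambda>h. c (t + h)) \<longlongrightarrow> c t) (at 0)"
proof -
  have "((\<lambda>h. c t + h *\<^sub>R ((c (t + h) - c t) /\<^sub>R h)) \<longlongrightarrow> c t + 0 *\<^sub>R v) (at 0)"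
    using assms unfolding has_curve_derivative_def
    by (intro tendsto_add tendsto_const frechet_tendsto_scaleR_joint tendsto_ident_at)
  moreover have "\<forall>\<^sub>F h in at 0. c t + h *\<^sub>R ((c (t + h) - c t) /\<^sub>R h) = c (t + h)"
    by (auto simp: eventually_at_filter)
  ultimately show ?thesis
    by (auto dest: Lim_transform_eventually)
qed

lemma has_curve_derivative_isCont:
  fixes c :: "real \<Rightarrow> 'a::frechet_space"
  assumes "has_curve_derivative c v t"
  shows "isCont c t"
  using has_curve_derivative_tendsto[OF assms] by (simp add: isCont_iff)

lemma has_curve_derivative_unique:
  fixes c :: "real \<Rightarrow> 'a::{real_vector, t2_space}"
  assumes "has_curve_derivative c v t" "has_curve_derivative c w t"
  shows "v = w"
  using assms unfolding has_curve_derivative_def by (auto intro: tendsto_unique[rotated])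

text \<open>Caratheodory's form of differentiability: it suffices that the increment is \<open>h\<close> times a
quantity with a limit. The fundamental theorem of calculus will supply such a quantity.\<close>

lemma has_curve_derivativeI:
  fixes c :: "real \<Rightarrow> 'a::frechet_space"
  assumes eq: "\<And>h. c (t + h) - c t = h *\<^sub>R \<Phi> h" and lim: "(\<Phi> \<longlongrightarrow> v) (at 0)"
  shows "has_curve_derivative c v t"
  unfolding has_curve_derivative_def
  by (rule Lim_transform_eventually[OF lim]) (auto simp: eq eventually_at_filter)

lemma has_curve_derivative_const: "has_curve_derivative (\<lambda>_. c) 0 t"
  by (simp add: has_curve_derivative_def)

lemma has_curve_derivative_id: "has_curve_derivative (\<lambda>x::real. x) 1 t"
  by (rule has_curve_derivativeI[where \<Phi> = "\<lambda>_. 1"]) auto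

lemma has_curve_derivative_add:
  fixes c :: "real \<Rightarrow> 'a::frechet_space"
  assumes "has_curve_derivative c v t" "has_curve_derivative d w t"
  shows "has_curve_derivative (\<lambda>t. c t + d t) (v + w) t"
proof -
  have "(\<lambda>h. (c (t + h) + d (t + h) - (c t + d t)) /\<^sub>R h) =
      (\<lambda>h. (c (t + h) - c t) /\<^sub>R h + (d (t + h) - d t) /\<^sub>R h)"
    by (simp add: add_diff_add scaleR_add_right)
  then show ?thesis
    using assms unfolding has_curve_derivative_def by (simp add: tendsto_add)
qed

text \<open>The usual splitting of the increment of a product. One factor is evaluated at \<open>t + h\<close>, which is
why the joint continuity of the bilinear map is used.\<close>

lemma has_curve_derivative_bilinear:
  fixes B :: "'a::frechet_space \<Rightarrow> 'b::frechet_space \<Rightarrow> 'c::frechet_space"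
  assumes B: "bilinear B" and cont: "continuous_on UNIV (\<lambda>(x, y). B x y)"
    and c: "has_curve_derivative c v t" and d: "has_curve_derivative d w t"
  shows "has_curve_derivative (\<lambda>t. B (c t) (d t)) (B v (d t) + B (c t) w) t"
proof -
  have lim: "((\<lambda>h. B (f h) (g h)) \<longlongrightarrow> B x y) (at 0)"
    if "(f \<longlongrightarrow> x) (at 0)" "(g \<longlongrightarrow> y) (at 0)" for f g x y
  proof -
    have "isCont (\<lambda>(x, y). B x y) (x, y)"
      using cont by (simp add: continuous_on_eq_continuous_at)
    from isCont_tendsto_compose[OF this tendsto_Pair[OF that]] show ?thesis by simp
  qed
  have eq: "(B (c (t + h)) (d (t + h)) - B (c t) (d t)) /\<^sub>R h =
      B ((c (t + h) - c t) /\<^sub>R h) (d (t + h)) + B (c t) ((d (t + h) - d t) /\<^sub>R h)" for h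
    by (simp add: bilinear_lmul[OF B] bilinear_rmul[OF B] bilinear_lsub[OF B] bilinear_rsub[OF B]
        scaleR_diff_right)
  show ?thesis
    unfolding has_curve_derivative_def eq
    using c d has_curve_derivative_tendsto[OF d] unfolding has_curve_derivative_def
    by (intro tendsto_add lim tendsto_const)
qed

lemma bilinear_scaleR: "bilinear (\<lambda>r x. r *\<^sub>R (x::'a::real_vector))"
  by (auto simp: bilinear_def linear_iff algebra_simps)

lemma continuous_scaleR_joint: "continuous_on UNIV (\<lambda>(r, x::'a::frechet_space). r *\<^sub>R x)"
  unfolding case_prod_beta by (intro frechet_continuous_on_scaleR continuous_intros)

lemmas has_curve_derivative_scaleR =
  has_curve_derivative_bilinear[OF bilinear_scaleR continuous_scaleR_joint]

lemma has_curve_derivative_affine: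
  fixes c :: "real \<Rightarrow> 'a::frechet_space"
  assumes "has_curve_derivative c v (x + \<theta> * r)"
  shows "has_curve_derivative (\<lambda>\<theta>. c (x + \<theta> * r)) (r *\<^sub>R v) \<theta>"
proof (cases "r = 0")
  case True
  then show ?thesis by (simp add: has_curve_derivative_const)
next
  case False
  have lim: "filterlim (\<lambda>h. h * r) (at 0) (at (0::real))"
    using False unfolding filterlim_at
    by (auto simp: eventually_at_filter intro!: tendsto_eq_intros)
  have "((\<lambda>h. (c (x + \<theta> * r + h) - c (x + \<theta> * r)) /\<^sub>R h) \<longlongrightarrow> v) (at 0)"
    using assms by (simp add: has_curve_derivative_def)
  note frechet_tendsto_scaleR[OF filterlim_compose[OF this lim], of r]
  moreover have "r *\<^sub>R ((c (x + \<theta> * r + h * r) - c (x + \<theta> * r)) /\<^sub>R (h * r)) =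
      (c (x + (\<theta> + h) * r) - c (x + \<theta> * r)) /\<^sub>R h" for h
    using False by (simp add: algebra_simps del: scaleR_diff_right)
  ultimately show ?thesis
    by (simp add: has_curve_derivative_def)
qed

text \<open>The mean value inequality, for one seminorm and for the deviation from a linear curve. As a
seminorm need not be differentiable along a curve, the inequality is shown with an error \<open>e\<close> per unit of length:
it then holds on all short intervals around each point, is additive over adjacent intervals, and
so holds on the whole interval by bisection.\<close>

lemma curve_increment_bound:
  fixes c :: "real \<Rightarrow> 'a::frechet_space"
  assumes p: "cont_seminorm p" and "a \<le> b"
    and c: "\<And>x. x \<in> {a..b} \<Longrightarrow> has_curve_derivative c (c' x) x"
    and M: "\<And>x. x \<in> {a..b} \<Longrightarrow> p (c' x - v) \<le> M"
  shows "p (c b - c a - (b - a) *\<^sub>R v) \<le> M * (b - a)"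
proof -
  have bound: "p (c b - c a - (b - a) *\<^sub>R v) \<le> (M + e) * (b - a)" if e: "e > 0" for e
    using \<open>a \<le> b\<close>
  proof (induction rule: Bolzano)
    case (trans u x w)
    have "p ((c x - c u - (x - u) *\<^sub>R v) + (c w - c x - (w - x) *\<^sub>R v))
        \<le> (M + e) * (x - u) + (M + e) * (w - x)"
      using trans by (intro order_trans[OF cont_seminorm_triangle[OF p]] add_mono)
    then show ?case by (simp add: algebra_simps)
  next
    case (local x)
    have "\<forall>\<^sub>F h in at 0. p ((c (x + h) - c x) /\<^sub>R h - c' x) < e"
      using c[of x] local e unfolding has_curve_derivative_def
      by (intro frechet_tendstoD_less[OF p]) auto
    then obtain d where d: "d > 0"
      and less: "\<And>h. h \<noteq> 0 \<Longrightarrow> \<bar>h\<bar> < d \<Longrightarrow> p ((c (x + h) - c x) /\<^sub>R h - c' x) < e"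
      by (auto simp: eventually_at)
    have step: "p (c (x + h) - c x - h *\<^sub>R v) \<le> (M + e) * \<bar>h\<bar>" if "\<bar>h\<bar> < d" for h
    proof (cases "h = 0")
      case True
      then show ?thesis by (simp add: cont_seminorm_zero[OF p])
    next
      case False
      have "p ((c (x + h) - c x) /\<^sub>R h - v) \<le> M + e"
        using cont_seminorm_diff_triangle[OF p, of "(c (x + h) - c x) /\<^sub>R h" v "c' x"]
          less[OF False that] M[of x] local by auto
      then have "\<bar>h\<bar> * p ((c (x + h) - c x) /\<^sub>R h - v) \<le> (M + e) * \<bar>h\<bar>"
        by (simp add: mult.commute mult_left_mono)
      then show ?thesis
        using False by (simp add: cont_seminorm_scaleR[OF p, symmetric] scaleR_diff_right)
    qed
    have "p (c w - c u - (w - u) *\<^sub>R v) \<le> (M + e) * (w - u)"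
      if "u \<le> x" "x \<le> w" "w - u < d" for u w
    proof -
      have "p ((c w - c x - (w - x) *\<^sub>R v) - (c u - c x - (u - x) *\<^sub>R v))
          \<le> (M + e) * \<bar>w - x\<bar> + (M + e) * \<bar>u - x\<bar>"
        using step[of "w - x"] step[of "u - x"] that
          cont_seminorm_triangle_diff[OF p, of "c w - c x - (w - x) *\<^sub>R v" "c u - c x - (u - x) *\<^sub>R v"]
        by auto
      then show ?thesis using that by (simp add: algebra_simps)
    qed
    then show ?case using d by blast
  qed
  have "p (c b - c a - (b - a) *\<^sub>R v) \<le> M * (b - a) + e * (b - a)" if "e > 0" for e
    using bound[OF that] by (simp only: distrib_right)
  moreover have "((\<lambda>e. M * (b - a) + e * (b - a)) \<longlongrightarrow> M * (b - a) + 0 * (b - a)) (at_right 0)"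
    by (intro tendsto_intros)
  ultimately show ?thesis
    by (intro tendsto_lowerbound[of "\<lambda>e. M * (b - a) + e * (b - a)" _ "at_right 0"])
       (auto simp: eventually_at_filter)
qed

section \<open>The integral over the unit interval\<close>

definition riemann_sum :: "(real \<Rightarrow> 'a::real_vector) \<Rightarrow> nat \<Rightarrow> 'a" where
  "riemann_sum c N = (\<Sum>i<N. c (real i / real N)) /\<^sub>R real N"

definition unit_integral :: "(real \<Rightarrow> 'a::{real_vector, t2_space}) \<Rightarrow> 'a" where
  "unit_integral c = lim (\<lambda>n. riemann_sum c (Suc n))"

lemma riemann_sum_bound:
  assumes p: "cont_seminorm p" and N: "N > 0" and M: "\<And>x. x \<in> {0..1} \<Longrightarrow> p (c x) \<le> M"
  shows "p (riemann_sum c N) \<le> M"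
proof -
  have "p (\<Sum>i<N. c (real i / real N)) \<le> (\<Sum>i<N. p (c (real i / real N)))"
    by (rule cont_seminorm_sum[OF p])
  also have "\<dots> \<le> (\<Sum>i<N. M)"
    by (intro sum_mono M) auto
  finally show ?thesis
    using N by (simp add: riemann_sum_def cont_seminorm_scaleR[OF p] field_simps)
qed

text \<open>Each sample value of the coarse sum is compared with the \<open>M\<close> sample values of the
fine sum that lie in the same subinterval.\<close>

lemma riemann_sum_refine:
  assumes p: "cont_seminorm p" and N: "N > 0" and M: "M > 0" and "e \<ge> 0"
    and osc: "\<And>x y. x \<in> {0..1} \<Longrightarrow> y \<in> {0..1} \<Longrightarrow> \<bar>x - y\<bar> \<le> 1 / real N \<Longrightarrow> p (c x - c y) \<le> e"
  shows "p (riemann_sum c N - riemann_sum c (N * M)) \<le> e"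
proof -
  \<comment> \<open>sample points of the fine sum, grouped by subintervals of the coarse one\<close>
  have refined: "(\<Sum>k<N * M. c (real k / real (N * M))) =
      (\<Sum>i<N. \<Sum>j<M. c (real (i * M + j) / real (N * M)))"
  proof -
    have "(\<Sum>j<M. f (i * M + j)) = sum f {i * M..<i * M + M}" for f :: "nat \<Rightarrow> 'a" and i
      using sum.shift_bounds_nat_ivl[of f 0 "i * M" M] by (simp add: lessThan_atLeast0 add.commute)
    then have "sum f {..<N * M} = (\<Sum>i<N. \<Sum>j<M. f (i * M + j))" for f :: "nat \<Rightarrow> 'a"
      by (simp only: sum.nat_group)
    from this[of "\<lambda>k. c (real k / real (N * M))"] show ?thesis .
  qed
  have coarse: "real M *\<^sub>R (\<Sum>i<N. c (real i / real N)) = (\<Sum>i<N. \<Sum>j<M. c (real i / real N))"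
    by (simp add: scaleR_right.sum sum_constant_scaleR)
  have "riemann_sum c N = (real M *\<^sub>R (\<Sum>i<N. c (real i / real N))) /\<^sub>R real (N * M)"
    using N M by (simp add: riemann_sum_def field_simps)
  then have "riemann_sum c N - riemann_sum c (N * M) =
      (\<Sum>i<N. \<Sum>j<M. c (real i / real N) - c (real (i * M + j) / real (N * M))) /\<^sub>R real (N * M)"
    unfolding coarse by (simp only: riemann_sum_def refined sum_subtractf scaleR_diff_right)
  moreover have "p (\<Sum>i<N. \<Sum>j<M. c (real i / real N) - c (real (i * M + j) / real (N * M)))
      \<le> (\<Sum>i<N. \<Sum>j<M. e)"
  proof (intro order_trans[OF cont_seminorm_sum[OF p]] sum_mono osc)
    fix i j assume "i \<in> {..<N}" "j \<in> {..<M}"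
    then have i: "i < N" and j: "j < M" by auto
    show "real i / real N \<in> {0..1}" using i by auto
    have eq: "real (i * M + j) / real (N * M) = real i / real N + real j / real (N * M)"
      using M by (simp add: add_divide_distrib)
    have "i * M + j < Suc i * M" using j by simp
    also have "\<dots> \<le> N * M" using i by (intro mult_right_mono) auto
    finally have "real (i * M + j) \<le> real (N * M)" by linarith
    then show "real (i * M + j) / real (N * M) \<in> {0..1}"
      using N M by (auto simp: divide_le_eq)
    show "\<bar>real i / real N - real (i * M + j) / real (N * M)\<bar> \<le> 1 / real N"
      unfolding eq using N M j by (simp add: field_simps)
  qed
  then have "p (\<Sum>i<N. \<Sum>j<M. c (real i / real N) - c (real (i * M + j) / real (N * M)))
      \<le> real (N * M) * e" by simp
  ultimately show ?thesis
    using N M by (simp add: cont_seminorm_scaleR[OF p] field_simps)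
qed

text \<open>Uniform continuity with respect to one seminorm. It is obtained from the uniform continuity of the
real function \<open>(x, y) \<mapsto> p (c x - c y)\<close> on the unit square, as \<open>c\<close> takes
values in a space without a distinguished metric.\<close>

lemma uniform_oscillation:
  fixes c :: "real \<Rightarrow> 'a::frechet_space"
  assumes p: "cont_seminorm p" and c: "continuous_on {0..1} c" and e: "e > 0"
  obtains N0 where "N0 > 0"
    "\<And>N x y. N \<ge> N0 \<Longrightarrow> x \<in> {0..1} \<Longrightarrow> y \<in> {0..1} \<Longrightarrow> \<bar>x - y\<bar> \<le> 1 / real N \<Longrightarrow> p (c x - c y) \<le> e"
proof -
  have "continuous_on ({0..1} \<times> {0..1}) (\<lambda>z. p (c (fst z) - c (snd z)))"
    by (intro cont_seminorm_continuous_on[OF p] continuous_on_diff continuous_on_compose2[OF c]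
        continuous_intros) auto
  then have "uniformly_continuous_on ({0..1} \<times> {0..1}) (\<lambda>z. p (c (fst z) - c (snd z)))"
    by (rule compact_uniformly_continuous) (intro compact_Times compact_Icc)
  then obtain d where d: "d > 0" and D: "\<And>z z'. z \<in> {0..1} \<times> {0..1} \<Longrightarrow> z' \<in> {0..1} \<times> {0..1} \<Longrightarrow>
      dist z' z < d \<Longrightarrow> dist (p (c (fst z') - c (snd z'))) (p (c (fst z) - c (snd z))) < e"
    using e unfolding uniformly_continuous_on_def by meson
  obtain N0 where N0: "1 / real (Suc N0) < d"
    using d nat_approx_posE by blast
  show thesis
  proof (rule that[of "Suc N0"])
    fix N :: nat and x y :: real
    assume xy: "x \<in> {0..1}" "y \<in> {0..1}" "\<bar>x - y\<bar> \<le> 1 / real N" and "N \<ge> Suc N0"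
    then have "1 / real N \<le> 1 / real (Suc N0)"
      by (intro divide_left_mono) auto
    then have "dist (x, y) (y, y) < d"
      using xy N0 by (simp add: dist_Pair_Pair dist_real_def)
    from D[OF _ _ this] show "p (c x - c y) \<le> e"
      using xy by (simp add: cont_seminorm_zero[OF p])
  qed auto
qed

text \<open>Two Riemann sums are both close to the sum over their common refinement.\<close>

lemma unit_integral_sums:
  fixes c :: "real \<Rightarrow> 'a::frechet_space"
  assumes c: "continuous_on {0..1} c"
  shows "(\<lambda>n. riemann_sum c (Suc n)) \<longlonglongrightarrow> unit_integral c"
proof -
  have "convergent (\<lambda>n. riemann_sum c (Suc n))"
  proof (rule frechet_Cauchy_convergent)
    fix p :: "'a \<Rightarrow> real" and e :: real assume p: "cont_seminorm p" and e: "e > 0"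
    obtain N0 where osc: "\<And>N x y. N \<ge> N0 \<Longrightarrow> x \<in> {0..1} \<Longrightarrow> y \<in> {0..1} \<Longrightarrow>
        \<bar>x - y\<bar> \<le> 1 / real N \<Longrightarrow> p (c x - c y) \<le> e / 3"
      using uniform_oscillation[OF p c, of "e / 3"] e by (metis divide_pos_pos zero_less_numeral)
    have "p (riemann_sum c (Suc i) - riemann_sum c (Suc j)) < e" if "i \<ge> N0" "j \<ge> N0" for i j
    proof -
      have "p (riemann_sum c (Suc i) - riemann_sum c (Suc i * Suc j)) \<le> e / 3"
        using that e by (intro riemann_sum_refine[OF p] osc[of "Suc i"]) auto
      moreover have "p (riemann_sum c (Suc j) - riemann_sum c (Suc j * Suc i)) \<le> e / 3"
        using that e by (intro riemann_sum_refine[OF p] osc[of "Suc j"]) auto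
      ultimately show ?thesis
        using cont_seminorm_diff_triangle[OF p, of "riemann_sum c (Suc i)" "riemann_sum c (Suc j)"
            "riemann_sum c (Suc i * Suc j)"] e
          cont_seminorm_commute[OF p, of "riemann_sum c (Suc j)" "riemann_sum c (Suc i * Suc j)"]
        by (simp only: mult.commute)
    qed
    then show "\<exists>M. \<forall>i\<ge>M. \<forall>j\<ge>M. p (riemann_sum c (Suc i) - riemann_sum c (Suc j)) < e"
      by blast
  qed
  then show ?thesis
    unfolding unit_integral_def by (simp add: convergent_LIMSEQ_iff)
qed

lemma unit_integral_eqI:
  fixes c :: "real \<Rightarrow> 'a::frechet_space"
  assumes "(\<lambda>n. riemann_sum c (Suc n)) \<longlonglongrightarrow> v"
  shows "unit_integral c = v"
  unfolding unit_integral_def using assms by (rule limI)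

lemma unit_integral_add:
  fixes c :: "real \<Rightarrow> 'a::frechet_space"
  assumes "continuous_on {0..1} c" "continuous_on {0..1} d"
  shows "unit_integral (\<lambda>x. c x + d x) = unit_integral c + unit_integral d"
  by (rule unit_integral_eqI)
     (use tendsto_add[OF unit_integral_sums[OF assms(1)] unit_integral_sums[OF assms(2)]] in
       \<open>simp add: riemann_sum_def sum.distrib scaleR_add_right\<close>)

lemma unit_integral_scaleR:
  fixes c :: "real \<Rightarrow> 'a::frechet_space"
  assumes "continuous_on {0..1} c"
  shows "unit_integral (\<lambda>x. r *\<^sub>R c x) = r *\<^sub>R unit_integral c"
  by (rule unit_integral_eqI)
     (use frechet_tendsto_scaleR[OF unit_integral_sums[OF assms], of r] in
       \<open>simp add: riemann_sum_def scaleR_right.sum[symmetric] mult.commute\<close>)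

lemma unit_integral_diff:
  fixes c :: "real \<Rightarrow> 'a::frechet_space"
  assumes "continuous_on {0..1} c" "continuous_on {0..1} d"
  shows "unit_integral (\<lambda>x. c x - d x) = unit_integral c - unit_integral d"
  by (rule unit_integral_eqI)
     (use tendsto_diff[OF unit_integral_sums[OF assms(1)] unit_integral_sums[OF assms(2)]] in
       \<open>simp add: riemann_sum_def sum_subtractf scaleR_diff_right\<close>)

lemma unit_integral_const: "unit_integral (\<lambda>_. v) = (v::'a::frechet_space)"
  by (rule unit_integral_eqI) (simp add: riemann_sum_def sum_constant_scaleR)

lemma unit_integral_bound:
  fixes c :: "real \<Rightarrow> 'a::frechet_space"
  assumes p: "cont_seminorm p" and c: "continuous_on {0..1} c"
    and M: "\<And>x. x \<in> {0..1} \<Longrightarrow> p (c x) \<le> M"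
  shows "p (unit_integral c) \<le> M"
proof -
  have "isCont p (unit_integral c)"
    using p by (simp add: cont_seminorm_def continuous_on_eq_continuous_at)
  from isCont_tendsto_compose[OF this unit_integral_sums[OF c]] show ?thesis
    by (rule tendsto_upperbound) (auto intro!: always_eventually riemann_sum_bound[OF p] M)
qed

text \<open>By compactness of the unit interval, \<open>f (y, x)\<close> is close to \<open>f (y0, x)\<close> uniformly in \<open>x\<close>.
The derivatives of composites and of primitives below are consequences of this continuity in
parameters.\<close>

lemma unit_integral_continuous:
  fixes f :: "'b::topological_space \<times> real \<Rightarrow> 'a::frechet_space"
  assumes f: "continuous_on UNIV f"
  shows "continuous_on UNIV (\<lambda>y. unit_integral (\<lambda>x. f (y, x)))"
  unfolding continuous_on_def
proof (intro ballI frechet_tendstoI_less)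
  fix y0 :: 'b and p :: "'a \<Rightarrow> real" and e :: real
  assume p: "cont_seminorm p" and e: "e > 0"
  note cont = continuous_on_compose2[OF f]
  have slice: "continuous_on {0..1} (\<lambda>x. f (y, x))" for y
    by (intro cont continuous_intros) auto
  have "continuous_on (UNIV \<times> {0..1}) (\<lambda>z. p (f (fst z, snd z) - f (y0, snd z)))"
    by (intro cont_seminorm_continuous_on[OF p] continuous_on_diff cont continuous_intros) auto
  note prod_compactE = continuous_on_prod_compactE[OF this compact_Icc UNIV_I half_gt_zero[OF e]]
  obtain Y where Y: "y0 \<in> Y" "open Y"
    and near: "\<forall>y\<in>Y \<inter> UNIV. \<forall>x\<in>{0..1}. dist (p (f (fst (y, x), snd (y, x)) - f (y0, snd (y, x))))
      (p (f (fst (y0, x), snd (y0, x)) - f (y0, snd (y0, x)))) \<le> e / 2"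
    by (rule prod_compactE)
  have D: "p (f (y, x) - f (y0, x)) \<le> e / 2" if "y \<in> Y" "x \<in> {0..1}" for y x
    using near that by (simp add: cont_seminorm_zero[OF p] dist_real_def cont_seminorm_nonneg[OF p])
  have "p (unit_integral (\<lambda>x. f (y, x)) - unit_integral (\<lambda>x. f (y0, x))) < e" if "y \<in> Y" for y
    using unit_integral_bound[OF p continuous_on_diff[OF slice[of y] slice[of y0]] D[OF that]] e
    by (simp add: unit_integral_diff[OF slice slice])
  then show "\<forall>\<^sub>F y in at y0 within UNIV.
      p (unit_integral (\<lambda>x. f (y, x)) - unit_integral (\<lambda>x. f (y0, x))) < e"
    using Y by (auto simp: eventually_at_topological)
qed

text \<open>The fundamental theorem of calculus: the increment of \<open>c\<close> is a sum of increments over the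
subintervals, and by the mean value inequality each of them is close to the corresponding
term of the Riemann sum.\<close>

lemma unit_integral_derivative:
  fixes c :: "real \<Rightarrow> 'a::frechet_space"
  assumes c: "\<And>x. has_curve_derivative c (c' x) x" and c': "continuous_on {0..1} c'"
  shows "unit_integral c' = c 1 - c 0"
proof (intro unit_integral_eqI frechet_tendstoI_less)
  fix p :: "'a \<Rightarrow> real" and e :: real assume p: "cont_seminorm p" and e: "e > 0"
  obtain N0 where osc: "\<And>N x y. N \<ge> N0 \<Longrightarrow> x \<in> {0..1} \<Longrightarrow> y \<in> {0..1} \<Longrightarrow>
      \<bar>x - y\<bar> \<le> 1 / real N \<Longrightarrow> p (c' x - c' y) \<le> e / 2"
    using uniform_oscillation[OF p c', of "e / 2"] e by (metis half_gt_zero)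
  have "p (riemann_sum c' (Suc n) - (c 1 - c 0)) < e" if n: "n \<ge> N0" for n
  proof -
    define N where "N = Suc n"
    have N: "N > 0" "N \<ge> N0" using n by (auto simp: N_def)
    define step where "step i = c (real (Suc i) / real N) - c (real i / real N)" for i
    have "c 1 - c 0 = (\<Sum>i<N. step i)"
      unfolding step_def using sum_lessThan_telescope[of "\<lambda>i. c (real i / real N)" N] N by simp
    then have eq: "(c 1 - c 0) - riemann_sum c' N =
        (\<Sum>i<N. step i - (1 / real N) *\<^sub>R c' (real i / real N))"
      by (simp add: riemann_sum_def sum_subtractf scaleR_right.sum inverse_eq_divide)
    have "p (step i - (1 / real N) *\<^sub>R c' (real i / real N)) \<le> e / 2 * (1 / real N)" if "i < N" for i
    proof -
      have len: "real (Suc i) / real N - real i / real N = 1 / real N"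
        by (simp add: add_divide_distrib)
      have "p (c (real (Suc i) / real N) - c (real i / real N) -
          (real (Suc i) / real N - real i / real N) *\<^sub>R c' (real i / real N))
          \<le> e / 2 * (real (Suc i) / real N - real i / real N)"
      proof (rule curve_increment_bound[OF p _ c])
        show "real i / real N \<le> real (Suc i) / real N" by (intro divide_right_mono) auto
        fix x assume x: "x \<in> {real i / real N..real (Suc i) / real N}"
        have "real (Suc i) / real N \<le> 1"
          using \<open>i < N\<close> by (simp add: divide_le_eq)
        moreover have "0 \<le> real i / real N" by simp
        ultimately have "x \<in> {0..1}" "real i / real N \<in> {0..1}" "\<bar>x - real i / real N\<bar> \<le> 1 / real N"
          using x len unfolding atLeastAtMost_iff by linarith+
        then show "p (c' x - c' (real i / real N)) \<le> e / 2"
          by (intro osc[OF N(2)])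
      qed
      then show ?thesis unfolding len step_def .
    qed
    then have "p (\<Sum>i<N. step i - (1 / real N) *\<^sub>R c' (real i / real N)) \<le> (\<Sum>i<N. e / 2 * (1 / real N))"
      by (intro order_trans[OF cont_seminorm_sum[OF p]] sum_mono) auto
    then have "p ((c 1 - c 0) - riemann_sum c' N) \<le> e / 2"
      unfolding eq using N by simp
    then show ?thesis
      using e cont_seminorm_commute[OF p, of "c 1 - c 0"] by (simp add: N_def)
  qed
  then show "\<forall>\<^sub>F n in sequentially. p (riemann_sum c' (Suc n) - (c 1 - c 0)) < e"
    by (auto simp: eventually_sequentially)
qed

text \<open>Hadamard's lemma. The right-hand side divided by \<open>h\<close> extends continuously to \<open>h = 0\<close>.\<close>

lemma curve_increment:
  fixes c :: "real \<Rightarrow> 'a::frechet_space"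
  assumes c: "\<And>x. has_curve_derivative c (c' x) x" and c': "continuous_on UNIV c'"
  shows "c (x + h) - c x = h *\<^sub>R unit_integral (\<lambda>\<theta>. c' (x + \<theta> * h))"
proof -
  have cont: "continuous_on {0..1} (\<lambda>\<theta>. c' (x + \<theta> * h))"
    by (intro continuous_on_compose2[OF c'] continuous_intros) auto
  have "unit_integral (\<lambda>\<theta>. h *\<^sub>R c' (x + \<theta> * h)) = c (x + 1 * h) - c (x + 0 * h)"
    by (intro unit_integral_derivative has_curve_derivative_affine c
        frechet_continuous_on_scaleR continuous_on_const cont)
  then show ?thesis
    by (simp add: unit_integral_scaleR[OF cont])
qed

lemma has_curve_derivative_zero_const:
  fixes c :: "real \<Rightarrow> 'a::frechet_space"
  assumes "\<And>x. has_curve_derivative c 0 x"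
  shows "c x = c y"
  using curve_increment[of c "\<lambda>_. 0" y "x - y"] assms by (simp add: unit_integral_const)

section \<open>Differentiable functions of two real variables\<close>

text \<open>Finitely often continuously differentiable functions. The partial derivatives are required to be of
the next lower class; this recursive form turns the closure properties below into inductions on \<open>k\<close>.\<close>

primrec Ck :: "nat \<Rightarrow> (real \<times> real \<Rightarrow> 'a::{real_vector, topological_space}) \<Rightarrow> bool" where
  "Ck 0 f \<longleftrightarrow> continuous_on UNIV f"
| "Ck (Suc k) f \<longleftrightarrow> continuous_on UNIV f \<and>
     (\<exists>f1 f2. Ck k f1 \<and> Ck k f2 \<and>
       (\<forall>x y. has_curve_derivative (\<lambda>x. f (x, y)) (f1 (x, y)) x) \<and>
       (\<forall>x y. has_curve_derivative (\<lambda>y. f (x, y)) (f2 (x, y)) y))"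

lemma Ck_continuous: "Ck k f \<Longrightarrow> continuous_on UNIV f"
  by (cases k) auto

lemma Ck_SucI:
  assumes "continuous_on UNIV f" "Ck k f1" "Ck k f2"
    "\<And>x y. has_curve_derivative (\<lambda>x. f (x, y)) (f1 (x, y)) x"
    "\<And>x y. has_curve_derivative (\<lambda>y. f (x, y)) (f2 (x, y)) y"
  shows "Ck (Suc k) f"
  using assms by auto

lemma Ck_SucE:
  assumes "Ck (Suc k) f"
  obtains f1 f2 where "continuous_on UNIV f" "Ck k f1" "Ck k f2"
    "\<And>x y. has_curve_derivative (\<lambda>x. f (x, y)) (f1 (x, y)) x"
    "\<And>x y. has_curve_derivative (\<lambda>y. f (x, y)) (f2 (x, y)) y"
  using assms by auto

lemma Ck_Suc_imp: "Ck (Suc k) f \<Longrightarrow> Ck k f"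
proof (induction k arbitrary: f)
  case 0
  then show ?case by simp
next
  case (Suc k)
  from Suc.prems obtain f1 f2 where f: "continuous_on UNIV f" "Ck (Suc k) f1" "Ck (Suc k) f2"
    "\<And>x y. has_curve_derivative (\<lambda>x. f (x, y)) (f1 (x, y)) x"
    "\<And>x y. has_curve_derivative (\<lambda>y. f (x, y)) (f2 (x, y)) y"
    by (rule Ck_SucE) blast
  then show ?case by (intro Ck_SucI[of f k f1 f2] Suc.IH)
qed

lemma Ck_const: "Ck k (\<lambda>_. v)"
proof (induction k arbitrary: v)
  case (Suc k)
  show ?case
    by (rule Ck_SucI[OF _ Suc.IH[of 0] Suc.IH[of 0]])
       (auto intro: continuous_intros has_curve_derivative_const)
qed simp

lemma Ck_fst: "Ck k (fst :: real \<times> real \<Rightarrow> real)"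
proof (cases k)
  case (Suc l)
  show ?thesis
    unfolding Suc
    by (rule Ck_SucI[OF _ Ck_const[of l 1] Ck_const[of l 0]])
       (auto intro: continuous_intros has_curve_derivative_const has_curve_derivative_id)
qed (auto intro: continuous_intros)

lemma Ck_snd: "Ck k (snd :: real \<times> real \<Rightarrow> real)"
proof (cases k)
  case (Suc l)
  show ?thesis
    unfolding Suc
    by (rule Ck_SucI[OF _ Ck_const[of l 0] Ck_const[of l 1]])
       (auto intro: continuous_intros has_curve_derivative_const has_curve_derivative_id)
qed (auto intro: continuous_intros)

lemma Ck_add:
  fixes f g :: "real \<times> real \<Rightarrow> 'a::frechet_space"
  shows "Ck k f \<Longrightarrow> Ck k g \<Longrightarrow> Ck k (\<lambda>z. f z + g z)"
proof (induction k arbitrary: f g)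
  case 0
  then show ?case by (auto intro: continuous_intros)
next
  case (Suc k)
  from Suc.prems(1) obtain f1 f2 where f: "continuous_on UNIV f" "Ck k f1" "Ck k f2"
    "\<And>x y. has_curve_derivative (\<lambda>x. f (x, y)) (f1 (x, y)) x"
    "\<And>x y. has_curve_derivative (\<lambda>y. f (x, y)) (f2 (x, y)) y"
    by (rule Ck_SucE) blast
  from Suc.prems(2) obtain g1 g2 where g: "continuous_on UNIV g" "Ck k g1" "Ck k g2"
    "\<And>x y. has_curve_derivative (\<lambda>x. g (x, y)) (g1 (x, y)) x"
    "\<And>x y. has_curve_derivative (\<lambda>y. g (x, y)) (g2 (x, y)) y"
    by (rule Ck_SucE) blast
  show ?case
    by (rule Ck_SucI[of _ k "\<lambda>z. f1 z + g1 z" "\<lambda>z. f2 z + g2 z"])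
       (intro continuous_on_add f g Suc.IH has_curve_derivative_add)+
qed

lemma Ck_bilinear:
  fixes B :: "'a::frechet_space \<Rightarrow> 'b::frechet_space \<Rightarrow> 'c::frechet_space"
  assumes B: "bilinear B" and cont: "continuous_on UNIV (\<lambda>(x, y). B x y)"
  shows "Ck k f \<Longrightarrow> Ck k g \<Longrightarrow> Ck k (\<lambda>z. B (f z) (g z))"
proof (induction k arbitrary: f g)
  have cont_B: "continuous_on UNIV (\<lambda>z. B (f z) (g z))"
    if "continuous_on UNIV f" "continuous_on UNIV g" for f :: "real \<times> real \<Rightarrow> _" and g
    using continuous_on_compose2[OF cont continuous_on_Pair[OF that]] by simp
  {
    case 0
    then show ?case by (simp add: cont_B)
  next
    case (Suc k)
    from Suc.prems(1) obtain f1 f2 where f: "continuous_on UNIV f" "Ck k f1" "Ck k f2"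
      "\<And>x y. has_curve_derivative (\<lambda>x. f (x, y)) (f1 (x, y)) x"
      "\<And>x y. has_curve_derivative (\<lambda>y. f (x, y)) (f2 (x, y)) y"
      by (rule Ck_SucE) blast
    from Suc.prems(2) obtain g1 g2 where g: "continuous_on UNIV g" "Ck k g1" "Ck k g2"
      "\<And>x y. has_curve_derivative (\<lambda>x. g (x, y)) (g1 (x, y)) x"
      "\<And>x y. has_curve_derivative (\<lambda>y. g (x, y)) (g2 (x, y)) y"
      by (rule Ck_SucE) blast
    show ?case
      by (rule Ck_SucI[of _ k "\<lambda>z. B (f1 z) (g z) + B (f z) (g1 z)"
              "\<lambda>z. B (f2 z) (g z) + B (f z) (g2 z)"])
         (intro cont_B f g Ck_add Suc.IH Ck_Suc_imp[OF Suc.prems(1)] Ck_Suc_imp[OF Suc.prems(2)]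
            has_curve_derivative_bilinear[OF B cont])+
  }
qed

lemmas Ck_scaleR = Ck_bilinear[OF bilinear_scaleR continuous_scaleR_joint]

text \<open>The chain rule. The increment is split into a horizontal and a vertical part, and
Hadamard's lemma writes each as an increment of \<open>\<phi>\<close> or \<open>\<psi>\<close> times an integral of a partial
derivative, with a limit by continuity in parameters.\<close>

lemma has_curve_derivative_chain2:
  fixes f :: "real \<times> real \<Rightarrow> 'a::frechet_space"
  assumes f1: "\<And>x y. has_curve_derivative (\<lambda>x. f (x, y)) (f1 (x, y)) x" "continuous_on UNIV f1"
    and f2: "\<And>x y. has_curve_derivative (\<lambda>y. f (x, y)) (f2 (x, y)) y" "continuous_on UNIV f2"
    and \<phi>: "has_curve_derivative \<phi> \<phi>' t" and \<psi>: "has_curve_derivative \<psi> \<psi>' t"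
  shows "has_curve_derivative (\<lambda>t. f (\<phi> t, \<psi> t)) (\<phi>' *\<^sub>R f1 (\<phi> t, \<psi> t) + \<psi>' *\<^sub>R f2 (\<phi> t, \<psi> t)) t"
proof -
  define K1 where "K1 z = unit_integral (\<lambda>\<theta>. f1 (\<phi> t + \<theta> * fst z, snd z))" for z :: "real \<times> real"
  define K2 where "K2 h = unit_integral (\<lambda>\<theta>. f2 (\<phi> t, \<psi> t + \<theta> * h))" for h :: real
  have slice1: "continuous_on UNIV (\<lambda>x. f1 (x, y))" for y
    by (intro continuous_on_compose2[OF f1(2)] continuous_intros) auto
  have slice2: "continuous_on UNIV (\<lambda>y. f2 (x, y))" for x
    by (intro continuous_on_compose2[OF f2(2)] continuous_intros) auto
  have inc: "f (\<phi> (t + h), \<psi> (t + h)) - f (\<phi> t, \<psi> t) =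
      (\<phi> (t + h) - \<phi> t) *\<^sub>R K1 (\<phi> (t + h) - \<phi> t, \<psi> (t + h)) + (\<psi> (t + h) - \<psi> t) *\<^sub>R K2 (\<psi> (t + h) - \<psi> t)"
    for h
  proof -
    have "f (\<phi> (t + h), \<psi> (t + h)) - f (\<phi> t, \<psi> (t + h)) =
        (\<phi> (t + h) - \<phi> t) *\<^sub>R K1 (\<phi> (t + h) - \<phi> t, \<psi> (t + h))"
      using curve_increment[OF f1(1) slice1, of "\<phi> t" "\<phi> (t + h) - \<phi> t" "\<psi> (t + h)"]
      by (simp add: K1_def)
    moreover have "f (\<phi> t, \<psi> (t + h)) - f (\<phi> t, \<psi> t) =
        (\<psi> (t + h) - \<psi> t) *\<^sub>R K2 (\<psi> (t + h) - \<psi> t)"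
      using curve_increment[OF f2(1) slice2, of "\<phi> t" "\<psi> t" "\<psi> (t + h) - \<psi> t"]
      by (simp add: K2_def)
    ultimately show ?thesis by (metis diff_add_cancel add_diff_eq)
  qed
  have lim\<phi>: "((\<lambda>h. \<phi> (t + h) - \<phi> t) \<longlongrightarrow> 0) (at 0)" and lim\<psi>: "((\<lambda>h. \<psi> (t + h)) \<longlongrightarrow> \<psi> t) (at 0)"
    using has_curve_derivative_tendsto[OF \<phi>] has_curve_derivative_tendsto[OF \<psi>]
    by (simp_all add: LIM_zero_iff)
  have cont1: "continuous_on UNIV K1"
    unfolding K1_def
    using unit_integral_continuous[of "\<lambda>(z, \<theta>). f1 (\<phi> t + \<theta> * fst z, snd z)"]
    by (simp add: case_prod_beta continuous_on_compose2[OF f1(2)] continuous_intros)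
  have cont2: "continuous_on UNIV K2"
    unfolding K2_def
    using unit_integral_continuous[of "\<lambda>(h, \<theta>). f2 (\<phi> t, \<psi> t + \<theta> * h)"]
    by (simp add: case_prod_beta continuous_on_compose2[OF f2(2)] continuous_intros)
  have "isCont K1 (0, \<psi> t)"
    using cont1 by (simp add: continuous_on_eq_continuous_at)
  from isCont_tendsto_compose[OF this tendsto_Pair[OF lim\<phi> lim\<psi>]]
  have lim1: "((\<lambda>h. K1 (\<phi> (t + h) - \<phi> t, \<psi> (t + h))) \<longlongrightarrow> f1 (\<phi> t, \<psi> t)) (at 0)"
    by (simp add: K1_def unit_integral_const)
  have "isCont K2 0"
    using cont2 by (simp add: continuous_on_eq_continuous_at)
  moreover have "((\<lambda>h. \<psi> (t + h) - \<psi> t) \<longlongrightarrow> 0) (at 0)"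
    using lim\<psi> by (simp add: LIM_zero_iff)
  ultimately have lim2: "((\<lambda>h. K2 (\<psi> (t + h) - \<psi> t)) \<longlongrightarrow> f2 (\<phi> t, \<psi> t)) (at 0)"
    using isCont_tendsto_compose[of 0 K2] by (simp add: K2_def unit_integral_const)
  have "((\<lambda>h. ((\<phi> (t + h) - \<phi> t) /\<^sub>R h) *\<^sub>R K1 (\<phi> (t + h) - \<phi> t, \<psi> (t + h)) +
      ((\<psi> (t + h) - \<psi> t) /\<^sub>R h) *\<^sub>R K2 (\<psi> (t + h) - \<psi> t))
      \<longlongrightarrow> \<phi>' *\<^sub>R f1 (\<phi> t, \<psi> t) + \<psi>' *\<^sub>R f2 (\<phi> t, \<psi> t)) (at 0)"
    using \<phi> \<psi> unfolding has_curve_derivative_def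
    by (intro tendsto_add frechet_tendsto_scaleR_joint lim1 lim2)
  then show ?thesis
    unfolding has_curve_derivative_def inc by (simp add: scaleR_add_right)
qed

lemma Ck_compose:
  fixes f :: "real \<times> real \<Rightarrow> 'a::frechet_space"
  shows "Ck k f \<Longrightarrow> Ck k \<phi> \<Longrightarrow> Ck k \<psi> \<Longrightarrow> Ck k (\<lambda>z. f (\<phi> z, \<psi> z))"
proof (induction k arbitrary: f)
  case 0
  then show ?case
    by (auto intro!: continuous_on_compose2[of UNIV f] continuous_intros)
next
  case (Suc k)
  from Suc.prems(1) obtain f1 f2 where f: "continuous_on UNIV f" "Ck k f1" "Ck k f2"
    "\<And>x y. has_curve_derivative (\<lambda>x. f (x, y)) (f1 (x, y)) x"
    "\<And>x y. has_curve_derivative (\<lambda>y. f (x, y)) (f2 (x, y)) y"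
    by (rule Ck_SucE) blast
  from Suc.prems(2) obtain \<phi>1 \<phi>2 where \<phi>: "continuous_on UNIV \<phi>" "Ck k \<phi>1" "Ck k \<phi>2"
    "\<And>x y. has_curve_derivative (\<lambda>x. \<phi> (x, y)) (\<phi>1 (x, y)) x"
    "\<And>x y. has_curve_derivative (\<lambda>y. \<phi> (x, y)) (\<phi>2 (x, y)) y"
    by (rule Ck_SucE) blast
  from Suc.prems(3) obtain \<psi>1 \<psi>2 where \<psi>: "continuous_on UNIV \<psi>" "Ck k \<psi>1" "Ck k \<psi>2"
    "\<And>x y. has_curve_derivative (\<lambda>x. \<psi> (x, y)) (\<psi>1 (x, y)) x"
    "\<And>x y. has_curve_derivative (\<lambda>y. \<psi> (x, y)) (\<psi>2 (x, y)) y"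
    by (rule Ck_SucE) blast
  note lower = Ck_Suc_imp[OF Suc.prems(2)] Ck_Suc_imp[OF Suc.prems(3)]
  show ?case
  proof (rule Ck_SucI)
    show "continuous_on UNIV (\<lambda>z. f (\<phi> z, \<psi> z))"
      using f(1) \<phi>(1) \<psi>(1) by (auto intro!: continuous_on_compose2[of UNIV f] continuous_intros)
    show "Ck k (\<lambda>z. \<phi>1 z *\<^sub>R f1 (\<phi> z, \<psi> z) + \<psi>1 z *\<^sub>R f2 (\<phi> z, \<psi> z))"
      by (intro Ck_add Ck_scaleR \<phi> \<psi> Suc.IH f lower)
    show "Ck k (\<lambda>z. \<phi>2 z *\<^sub>R f1 (\<phi> z, \<psi> z) + \<psi>2 z *\<^sub>R f2 (\<phi> z, \<psi> z))"
      by (intro Ck_add Ck_scaleR \<phi> \<psi> Suc.IH f lower)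
  qed (intro has_curve_derivative_chain2 f \<phi> \<psi> Ck_continuous[OF f(2)] Ck_continuous[OF f(3)])+
qed

text \<open>The integral of \<open>f (u, s)\<close> over \<open>u\<close> from \<open>0\<close> to \<open>t\<close>, oriented for negative \<open>t\<close>, after the
substitution \<open>u = x * t\<close>. The fixed domain of integration makes the time an ordinary parameter.\<close>

definition primitive :: "(real \<times> real \<Rightarrow> 'a::frechet_space) \<Rightarrow> real \<times> real \<Rightarrow> 'a" where
  "primitive f = (\<lambda>(t, s). t *\<^sub>R unit_integral (\<lambda>x. f (x * t, s)))"

lemma continuous_primitive:
  fixes f :: "real \<times> real \<Rightarrow> 'a::frechet_space"
  assumes f: "continuous_on UNIV f"
  shows "continuous_on UNIV (primitive f)"
proof -
  have "continuous_on UNIV (\<lambda>w. f (snd w * fst (fst w), snd (fst w)))"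
    by (intro continuous_on_compose2[OF f] continuous_intros) auto
  from unit_integral_continuous[OF this] show ?thesis
    unfolding primitive_def case_prod_beta
    by (intro frechet_continuous_on_scaleR continuous_intros) simp
qed

text \<open>The difference quotient is the integral of a function of \<open>x\<close> that depends continuously on \<open>h\<close>; at
\<open>h = 0\<close> that function is \<open>f (x * t, s) + x * t * f1 (x * t, s)\<close>, the derivative of
\<open>x * f (x * t, s)\<close>. The fundamental theorem yields the value \<open>f (t, s)\<close>.\<close>

lemma primitive_derivative_time:
  fixes f :: "real \<times> real \<Rightarrow> 'a::frechet_space"
  assumes f: "continuous_on UNIV f" and f1: "continuous_on UNIV f1"
    and deriv: "\<And>x y. has_curve_derivative (\<lambda>x. f (x, y)) (f1 (x, y)) x"
  shows "has_curve_derivative (\<lambda>t. primitive f (t, s)) (f (t, s)) t"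
proof (rule has_curve_derivativeI)
  define K where "K w = unit_integral (\<lambda>\<theta>. f1 (snd w * t + \<theta> * (snd w * fst w), s))"
    for w :: "real \<times> real"
  define \<Phi> where "\<Phi> h = unit_integral (\<lambda>x. f (x * (t + h), s) + (t * x) *\<^sub>R K (h, x))" for h
  have cont_slice: "continuous_on UNIV (\<lambda>x. f1 (x, s))"
    by (intro continuous_on_compose2[OF f1] continuous_intros) auto
  have "continuous_on UNIV (\<lambda>v. f1 (snd (fst v) * t + snd v * (snd (fst v) * fst (fst v)), s))"
    by (intro continuous_on_compose2[OF f1] continuous_intros) auto
  from unit_integral_continuous[OF this] have K: "continuous_on UNIV K"
    unfolding K_def by simp
  have "continuous_on UNIV (\<lambda>v. f (snd v * (t + fst v), s) + (t * snd v) *\<^sub>R K (fst v, snd v))"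
    by (intro continuous_on_add frechet_continuous_on_scaleR continuous_on_compose2[OF f]
        continuous_on_compose2[OF K] continuous_intros) auto
  from unit_integral_continuous[OF this] have "continuous_on UNIV \<Phi>"
    unfolding \<Phi>_def by simp
  then have "(\<Phi> \<longlongrightarrow> \<Phi> 0) (at 0)"
    by (simp add: continuous_on_def)
  also have "\<Phi> 0 = f (t, s)"
  proof -
    have "has_curve_derivative (\<lambda>x. x *\<^sub>R f (0 + x * t, s)) (1 *\<^sub>R f (0 + x * t, s) + x *\<^sub>R (t *\<^sub>R f1 (0 + x * t, s))) x"
      for x
      by (intro has_curve_derivative_scaleR has_curve_derivative_id
          has_curve_derivative_affine[of "\<lambda>x. f (x, s)"] deriv)
    from unit_integral_derivative[OF this] show ?thesis
      by (simp add: \<Phi>_def K_def unit_integral_const mult.commute continuous_on_add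
          frechet_continuous_on_scaleR continuous_on_compose2[OF f] continuous_on_compose2[OF f1]
          continuous_intros)
  qed
  finally show "(\<Phi> \<longlongrightarrow> f (t, s)) (at 0)" .
  fix h
  have inc: "f (x * (t + h), s) - f (x * t, s) = h *\<^sub>R (x *\<^sub>R K (h, x))" for x
    using curve_increment[OF deriv cont_slice, of "x * t" "x * h"]
    by (simp add: K_def algebra_simps)
  have cont_f: "continuous_on {0..1} (\<lambda>x. f (x * r, s))" for r
    by (intro continuous_on_compose2[OF f] continuous_intros) auto
  have cont_K: "continuous_on {0..1} (\<lambda>x. r *\<^sub>R (x *\<^sub>R K (h, x)))" for r
    by (intro frechet_continuous_on_scaleR continuous_on_compose2[OF K] continuous_intros) auto
  have "\<Phi> h = unit_integral (\<lambda>x. f (x * (t + h), s)) + t *\<^sub>R unit_integral (\<lambda>x. x *\<^sub>R K (h, x))"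
    using unit_integral_add[OF cont_f[of "t + h"] cont_K[of t]] unit_integral_scaleR[OF cont_K[of 1], of t]
    by (simp add: \<Phi>_def)
  moreover have "unit_integral (\<lambda>x. f (x * (t + h), s)) - unit_integral (\<lambda>x. f (x * t, s)) =
      h *\<^sub>R unit_integral (\<lambda>x. x *\<^sub>R K (h, x))"
    using unit_integral_diff[OF cont_f[of "t + h"] cont_f[of t]] unit_integral_scaleR[OF cont_K[of 1], of h]
    by (simp add: inc)
  ultimately show "primitive f (t + h, s) - primitive f (t, s) = h *\<^sub>R \<Phi> h"
    by (simp add: primitive_def scaleR_add_left scaleR_add_right scaleR_left_commute[of h t]
        scaleR_diff_right[symmetric] flip: add_diff_eq)
qed

text \<open>Differentiation under the integral sign, again by evaluating at \<open>h = 0\<close> an integral that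
represents the difference quotient.\<close>

lemma primitive_derivative_parameter:
  fixes f :: "real \<times> real \<Rightarrow> 'a::frechet_space"
  assumes f: "continuous_on UNIV f" and f2: "continuous_on UNIV f2"
    and deriv: "\<And>x y. has_curve_derivative (\<lambda>y. f (x, y)) (f2 (x, y)) y"
  shows "has_curve_derivative (\<lambda>s. primitive f (t, s)) (primitive f2 (t, s)) s"
proof (rule has_curve_derivativeI)
  define K where "K w = unit_integral (\<lambda>\<theta>. f2 (snd w * t, s + \<theta> * fst w))" for w :: "real \<times> real"
  define \<Phi> where "\<Phi> h = t *\<^sub>R unit_integral (\<lambda>x. K (h, x))" for h
  have cont_slice: "continuous_on UNIV (\<lambda>y. f2 (x, y))" for x
    by (intro continuous_on_compose2[OF f2] continuous_intros) auto
  have "continuous_on UNIV (\<lambda>v. f2 (snd (fst v) * t, s + snd v * fst (fst v)))"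
    by (intro continuous_on_compose2[OF f2] continuous_intros) auto
  from unit_integral_continuous[OF this] have K: "continuous_on UNIV K"
    unfolding K_def by simp
  from unit_integral_continuous[OF this] have "continuous_on UNIV \<Phi>"
    unfolding \<Phi>_def by (intro frechet_continuous_on_scaleR continuous_intros)
  then have "(\<Phi> \<longlongrightarrow> \<Phi> 0) (at 0)"
    by (simp add: continuous_on_def)
  also have "\<Phi> 0 = primitive f2 (t, s)"
    by (simp add: \<Phi>_def K_def unit_integral_const primitive_def)
  finally show "(\<Phi> \<longlongrightarrow> primitive f2 (t, s)) (at 0)" .
  fix h
  have cont_f: "continuous_on {0..1} (\<lambda>x. f (x * t, r))" for r
    by (intro continuous_on_compose2[OF f] continuous_intros) auto
  have cont_K: "continuous_on {0..1} (\<lambda>x. K (h, x))"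
    by (intro continuous_on_compose2[OF K] continuous_intros) auto
  have inc: "f (x * t, s + h) - f (x * t, s) = h *\<^sub>R K (h, x)" for x
    using curve_increment[OF deriv cont_slice, of "x * t" s h] by (simp add: K_def)
  show "primitive f (t, s + h) - primitive f (t, s) = h *\<^sub>R \<Phi> h"
  proof -
    have "unit_integral (\<lambda>x. f (x * t, s + h)) - unit_integral (\<lambda>x. f (x * t, s)) =
        h *\<^sub>R unit_integral (\<lambda>x. K (h, x))"
      using unit_integral_diff[OF cont_f[of "s + h"] cont_f[of s]] unit_integral_scaleR[OF cont_K, of h]
      by (simp add: inc)
    then show ?thesis
      by (simp add: primitive_def \<Phi>_def mult.commute[of h t] flip: scaleR_diff_right)
  qed
qed

text \<open>The time derivative of a primitive is the integrand, and its parameter derivative is the primitive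
of an integrand that is one class lower, to which the induction hypothesis applies.\<close>

lemma Ck_primitive:
  fixes f :: "real \<times> real \<Rightarrow> 'a::frechet_space"
  shows "Ck k f \<Longrightarrow> Ck k (primitive f)"
proof (induction k arbitrary: f)
  case 0
  then show ?case by (simp add: continuous_primitive)
next
  case (Suc k)
  from Suc.prems obtain f1 f2 where f: "continuous_on UNIV f" "Ck k f1" "Ck k f2"
    "\<And>x y. has_curve_derivative (\<lambda>x. f (x, y)) (f1 (x, y)) x"
    "\<And>x y. has_curve_derivative (\<lambda>y. f (x, y)) (f2 (x, y)) y"
    by (rule Ck_SucE) blast
  show ?case
    by (rule Ck_SucI[of _ k f "primitive f2"])
       (intro continuous_primitive f Suc.IH Ck_Suc_imp[OF Suc.prems]
          primitive_derivative_time[OF f(1) _ f(4)] primitive_derivative_parameter[OF f(1) _ f(5)]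
          Ck_continuous[OF f(2)] Ck_continuous[OF f(3)])+
qed

section \<open>Smooth functions of two variables and smooth curves\<close>

definition smooth2 :: "(real \<times> real \<Rightarrow> 'a::{real_vector, topological_space}) \<Rightarrow> bool" where
  "smooth2 f \<longleftrightarrow> (\<forall>k. Ck k f)"

text \<open>For each \<open>k\<close> the definition provides a partial derivative of class \<open>k\<close>; by uniqueness of
derivatives all of them are the same function.\<close>

lemma smooth2_partial_snd:
  fixes f :: "real \<times> real \<Rightarrow> 'a::frechet_space"
  assumes "smooth2 f"
  obtains g where "smooth2 g" "\<And>x y. has_curve_derivative (\<lambda>y. f (x, y)) (g (x, y)) y"
proof -
  have "\<exists>g. Ck k g \<and> (\<forall>x y. has_curve_derivative (\<lambda>y. f (x, y)) (g (x, y)) y)" for k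
  proof -
    have "Ck (Suc k) f" using assms unfolding smooth2_def by blast
    then show ?thesis by (rule Ck_SucE) blast
  qed
  then obtain G where G: "\<And>k. Ck k (G k)"
    "\<And>k x y. has_curve_derivative (\<lambda>y. f (x, y)) (G k (x, y)) y"
    by metis
  have "G k = G 0" for k
    using has_curve_derivative_unique[OF G(2) G(2)] by (auto simp: fun_eq_iff)
  then have "smooth2 (G 0)"
    using G(1) by (metis smooth2_def)
  then show thesis using G(2) that by blast
qed

lemma smooth2_smooth_curve:
  fixes f :: "real \<times> real \<Rightarrow> 'a::frechet_space"
  assumes "smooth2 f"
  shows "smooth_curve (\<lambda>s. f (x, s))"
proof -
  have "\<exists>F. \<forall>n. (smooth2 (F n) \<and> (n = 0 \<longrightarrow> F n = f)) \<and>
      (\<forall>x y. has_curve_derivative (\<lambda>y. F n (x, y)) (F (Suc n) (x, y)) y)"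
  proof (rule dependent_nat_choice)
    show "\<exists>g. smooth2 g \<and> (0 = (0::nat) \<longrightarrow> g = f)" using assms by blast
    fix g :: "real \<times> real \<Rightarrow> 'a" and n :: nat
    assume "smooth2 g \<and> (n = 0 \<longrightarrow> g = f)"
    then show "\<exists>h. (smooth2 h \<and> (Suc n = 0 \<longrightarrow> h = f)) \<and>
        (\<forall>x y. has_curve_derivative (\<lambda>y. g (x, y)) (h (x, y)) y)"
      by (metis smooth2_partial_snd nat.discI)
  qed
  then obtain F where "F 0 = f" "\<And>n x y. has_curve_derivative (\<lambda>y. F n (x, y)) (F (Suc n) (x, y)) y"
    by blast
  then show ?thesis
    unfolding smooth_curve_def by (intro exI[of _ "\<lambda>n s. F n (x, s)"]) simp
qed

lemma smooth2_curve:
  fixes c :: "real \<Rightarrow> 'a::frechet_space"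
  assumes "smooth_curve c"
  shows "smooth2 (\<lambda>z. c (snd z))"
proof -
  obtain D where D: "D 0 = c" "\<And>k t. has_curve_derivative (D k) (D (Suc k) t) t"
    using assms unfolding smooth_curve_def by blast
  have cont: "continuous_on UNIV (\<lambda>z::real \<times> real. D j (snd z))" for j
  proof -
    have "continuous_on UNIV (D j)"
      by (intro continuous_at_imp_continuous_on ballI has_curve_derivative_isCont[OF D(2)])
    then show ?thesis
      by (rule continuous_on_compose2) (auto intro: continuous_intros)
  qed
  have "Ck k (\<lambda>z. D j (snd z))" for k j
  proof (induction k arbitrary: j)
    case (Suc k)
    show ?case
      by (rule Ck_SucI[OF cont Ck_const[of k 0] Suc.IH[of "Suc j"]])
         (simp_all add: D has_curve_derivative_const)
  qed (simp add: cont)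
  from this[of _ 0] show ?thesis by (simp add: smooth2_def D(1))
qed

section \<open>Smooth curves of paths\<close>

lemma curve_deriv_eq:
  fixes c :: "real \<Rightarrow> 'a::frechet_space"
  assumes "has_curve_derivative c v t"
  shows "curve_deriv c t = v"
  using assms unfolding curve_deriv_def has_curve_derivative_def
  by (intro tendsto_Lim) auto

lemma iterated_curve_deriv:
  fixes D :: "nat \<Rightarrow> real \<Rightarrow> 'a::frechet_space"
  assumes "\<And>k t. has_curve_derivative (D k) (D (Suc k) t) t"
  shows "(curve_deriv ^^ k) (D 0) = D k"
proof (induction k)
  case (Suc k)
  then show ?case using curve_deriv_eq[OF assms] by auto
qed simp

definition path_deriv :: "nat \<Rightarrow> 'a::frechet_space smooth_path \<Rightarrow> real \<Rightarrow> 'a" where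
  "path_deriv k f = (curve_deriv ^^ k) (path_at f)"

lemma path_deriv_0: "path_deriv 0 f = path_at f"
  by (simp add: path_deriv_def)

lemma path_derivE:
  obtains D where "D 0 = path_at f" "\<And>k t. has_curve_derivative (D k) (D (Suc k) t) t"
    "\<And>k. path_deriv k f = D k"
proof -
  have "smooth_curve (path_at f)" using path_at[of f] by simp
  then obtain D where D: "D 0 = path_at f" "\<And>k t. has_curve_derivative (D k) (D (Suc k) t) t"
    unfolding smooth_curve_def by blast
  then show thesis
    using that[OF D] iterated_curve_deriv[of D] by (simp add: path_deriv_def)
qed

lemma has_curve_derivative_path_deriv:
  "has_curve_derivative (path_deriv k f) (path_deriv (Suc k) f t) t"
  by (rule path_derivE[of f]) simp

lemma continuous_on_path_deriv: "continuous_on S (path_deriv k f)"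
  by (intro continuous_at_imp_continuous_on ballI
      has_curve_derivative_isCont[OF has_curve_derivative_path_deriv])

lemma path_deriv_add: "path_deriv k (f + g) t = path_deriv k f t + path_deriv k g t"
proof -
  have "path_deriv k (f + g) = (curve_deriv ^^ k) (\<lambda>t. path_deriv 0 f t + path_deriv 0 g t)"
    by (simp add: path_deriv_def plus_smooth_path.rep_eq)
  also have "\<dots> = (\<lambda>t. path_deriv k f t + path_deriv k g t)"
    by (rule iterated_curve_deriv[of "\<lambda>k t. path_deriv k f t + path_deriv k g t"])
       (intro has_curve_derivative_add has_curve_derivative_path_deriv)
  finally show ?thesis by simp
qed

lemma path_deriv_scaleR: "path_deriv k (r *\<^sub>R f) t = r *\<^sub>R path_deriv k f t"
proof -
  have "path_deriv k (r *\<^sub>R f) = (curve_deriv ^^ k) (\<lambda>t. r *\<^sub>R path_deriv 0 f t)"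
    by (simp add: path_deriv_def scaleR_smooth_path.rep_eq)
  also have "\<dots> = (\<lambda>t. r *\<^sub>R path_deriv k f t)"
  proof (rule iterated_curve_deriv[of "\<lambda>k t. r *\<^sub>R path_deriv k f t"])
    show "has_curve_derivative (\<lambda>t. r *\<^sub>R path_deriv k f t) (r *\<^sub>R path_deriv (Suc k) f t) t" for k t
      using has_curve_derivative_scaleR[OF has_curve_derivative_const has_curve_derivative_path_deriv]
      by fastforce
  qed
  finally show ?thesis by simp
qed

lemma path_deriv_diff: "path_deriv k (f - g) t = path_deriv k f t - path_deriv k g t"
  using path_deriv_add[of k f "- 1 *\<^sub>R g"] path_deriv_scaleR[of k "-1" g] by simp

text \<open>A limit is tested on an open set of paths that are uniformly close to \<open>f\<close> on an interval. The
set of all \<open>g\<close> whose \<open>k\<close>-th derivative stays within some distance \<open>d < e\<close> of that of \<open>f\<close> is open: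
the gap between \<open>d\<close> and \<open>e\<close> leaves room for a neighbourhood of each of its points.\<close>

lemma smooth_path_tendsto_uniform:
  fixes F :: "_ \<Rightarrow> 'a::frechet_space smooth_path"
  assumes p: "cont_seminorm p" and lim: "(F \<longlongrightarrow> f) \<F>" and e: "e > 0"
  shows "\<forall>\<^sub>F y in \<F>. \<forall>t\<in>{-r..r}. p (path_deriv k (F y) t - path_deriv k f t) < e"
proof -
  define W where "W = {g. \<exists>d<e. \<forall>t\<in>{-r..r}. p (path_deriv k g t - path_deriv k f t) \<le> d}"
  have "open W"
    unfolding open_smooth_path_def
  proof
    fix g assume "g \<in> W"
    then obtain d where d: "d < e" "\<And>t. t \<in> {-r..r} \<Longrightarrow> p (path_deriv k g t - path_deriv k f t) \<le> d"
      by (auto simp: W_def)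
    define V where "V = {v. p v < (e - d) / 2}"
    have "open V"
      using p open_Collect_less[of p "\<lambda>_. (e - d) / 2"] by (simp add: V_def cont_seminorm_def)
    moreover have "0 \<in> V" using d(1) by (simp add: V_def cont_seminorm_zero[OF p])
    moreover have "path_nhd g V k r \<subseteq> W"
    proof
      fix g' assume "g' \<in> path_nhd g V k r"
      then have near: "p (path_deriv k g' t - path_deriv k g t) < (e - d) / 2" if "t \<in> {-r..r}" for t
        using that by (auto simp: path_nhd_def V_def path_deriv_def)
      have "p (path_deriv k g' t - path_deriv k f t) \<le> (e - d) / 2 + d" if "t \<in> {-r..r}" for t
        using near[OF that] d(2)[OF that]
          cont_seminorm_diff_triangle[OF p, of "path_deriv k g' t" "path_deriv k f t" "path_deriv k g t"]
        by linarith
      moreover have "(e - d) / 2 + d < e" using d(1) by (simp add: field_simps)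
      ultimately show "g' \<in> W" by (auto simp: W_def)
    qed
    ultimately show "\<exists>V n r. open V \<and> 0 \<in> V \<and> path_nhd g V n r \<subseteq> W" by blast
  qed
  moreover have "f \<in> W"
    using e by (auto simp: W_def cont_seminorm_zero[OF p])
  ultimately have "\<forall>\<^sub>F y in \<F>. F y \<in> W"
    using lim by (rule topological_tendstoD[rotated])
  then show ?thesis
    by eventually_elim (auto simp: W_def)
qed

lemma has_curve_derivative_path_eval:
  fixes c :: "real \<Rightarrow> 'a::frechet_space smooth_path"
  assumes "has_curve_derivative c v s"
  shows "has_curve_derivative (\<lambda>s. path_deriv k (c s) t) (path_deriv k v t) s"
  unfolding has_curve_derivative_def
proof (rule frechet_tendstoI_less)
  fix p :: "'a \<Rightarrow> real" and e :: real assume p: "cont_seminorm p" and e: "e > 0"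
  have "\<forall>\<^sub>F h in at 0. \<forall>u\<in>{-\<bar>t\<bar>..\<bar>t\<bar>}. p (path_deriv k ((c (s + h) - c s) /\<^sub>R h) u - path_deriv k v u) < e"
    by (rule smooth_path_tendsto_uniform[OF p assms[unfolded has_curve_derivative_def] e])
  moreover have "t \<in> {-\<bar>t\<bar>..\<bar>t\<bar>}" by auto
  ultimately show "\<forall>\<^sub>F h in at 0. p ((path_deriv k (c (s + h)) t - path_deriv k (c s) t) /\<^sub>R h - path_deriv k v t) < e"
    unfolding path_deriv_diff[symmetric] path_deriv_scaleR[symmetric]
    by (auto elim!: eventually_mono)
qed

text \<open>Difference quotients of the curve converge uniformly on compact intervals, so the
increments converge to \<open>0\<close> uniformly there; joint continuity then follows from the continuity of
each single path.\<close>

lemma continuous_path_eval: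
  fixes c :: "real \<Rightarrow> 'a::frechet_space smooth_path"
  assumes c: "\<And>s. has_curve_derivative c (c' s) s"
  shows "continuous_on UNIV (\<lambda>(t, s). path_deriv k (c s) t)"
  unfolding continuous_on_def
proof (intro ballI frechet_tendstoI_less)
  fix z :: "real \<times> real" and p :: "'a \<Rightarrow> real" and e :: real
  assume p: "cont_seminorm p" and e: "e > 0"
  obtain t s where z: "z = (t, s)" by (cases z)
  \<comment> \<open>\<open>[-r, r]\<close> contains all points at distance less than \<open>1\<close> from \<open>t\<close>\<close>
  define r where "r = \<bar>t\<bar> + 1"
  have "compact ((\<lambda>u. p (path_deriv k (c' s) u)) ` {-r..r})"
    by (intro compact_continuous_image cont_seminorm_continuous_on[OF p] continuous_on_path_deriv
        compact_Icc)
  then obtain M where M: "\<And>u. u \<in> {-r..r} \<Longrightarrow> p (path_deriv k (c' s) u) \<le> M"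
    by (meson bounded_imp_bdd_above compact_imp_bounded bdd_above.E imageI)
  have "\<forall>\<^sub>F h in at 0. \<forall>u\<in>{-r..r}.
      p (path_deriv k ((c (s + h) - c s) /\<^sub>R h) u - path_deriv k (c' s) u) < 1"
    using smooth_path_tendsto_uniform[OF p, of _ "c' s" "at 0" 1 r k] c[of s]
    by (simp add: has_curve_derivative_def)
  moreover have "\<forall>\<^sub>F h in at 0. \<bar>h\<bar> * (M + 1) < e / 2"
  proof -
    have "((\<lambda>h. \<bar>h\<bar> * (M + 1)) \<longlongrightarrow> \<bar>0\<bar> * (M + 1)) (at (0::real))"
      by (intro tendsto_intros)
    from order_tendstoD(2)[OF this, of "e / 2"] show ?thesis using e by simp
  qed
  ultimately have "\<forall>\<^sub>F h in at 0. \<forall>u\<in>{-r..r}. p (path_deriv k (c (s + h)) u - path_deriv k (c s) u) < e / 2"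
  proof eventually_elim
    case (elim h)
    show ?case
    proof
      fix u assume u: "u \<in> {-r..r}"
      show "p (path_deriv k (c (s + h)) u - path_deriv k (c s) u) < e / 2"
      proof (cases "h = 0")
        case True
        then show ?thesis using e by (simp add: cont_seminorm_zero[OF p])
      next
        case False
        let ?q = "path_deriv k ((c (s + h) - c s) /\<^sub>R h) u"
        have "p ?q \<le> M + 1"
          using elim(1) u M[OF u] cont_seminorm_triangle[OF p, of "?q - path_deriv k (c' s) u" "path_deriv k (c' s) u"]
          by force
        then have "\<bar>h\<bar> * p ?q \<le> \<bar>h\<bar> * (M + 1)"
          by (rule mult_left_mono) simp
        moreover have "path_deriv k (c (s + h)) u - path_deriv k (c s) u = h *\<^sub>R ?q"
          using False by (simp add: path_deriv_scaleR path_deriv_diff)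
        ultimately show ?thesis
          using elim(2) by (simp add: cont_seminorm_scaleR[OF p])
      qed
    qed
  qed
  then obtain d where d: "d > 0" and
    D: "\<And>h u. h \<noteq> 0 \<Longrightarrow> \<bar>h\<bar> < d \<Longrightarrow> u \<in> {-r..r} \<Longrightarrow> p (path_deriv k (c (s + h)) u - path_deriv k (c s) u) < e / 2"
    by (auto simp: eventually_at)
  have near_s: "p (path_deriv k (c y) x - path_deriv k (c s) x) < e / 2"
    if "\<bar>y - s\<bar> < d" "\<bar>x - t\<bar> < 1" for x y
  proof (cases "y = s")
    case True
    then show ?thesis using e by (simp add: cont_seminorm_zero[OF p])
  next
    case False
    have "x \<in> {-r..r}" using that(2) by (auto simp: r_def)
    then show ?thesis using D[of "y - s" x] False that(1) by simp
  qed
  have lim: "((\<lambda>w. fst w) \<longlongrightarrow> t) (at z)" "((\<lambda>w. snd w) \<longlongrightarrow> s) (at z)"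
    using tendsto_fst[OF tendsto_ident_at, of z UNIV] tendsto_snd[OF tendsto_ident_at, of z UNIV]
    by (simp_all add: z del: split_paired_All)
  have "isCont (path_deriv k (c s)) t"
    using has_curve_derivative_isCont[OF has_curve_derivative_path_deriv] .
  from frechet_tendstoD_less[OF p isCont_tendsto_compose[OF this lim(1)], of "e / 2"] e
  have "\<forall>\<^sub>F w in at z. p (path_deriv k (c s) (fst w) - path_deriv k (c s) t) < e / 2" by simp
  moreover have "\<forall>\<^sub>F w in at z. \<bar>fst w - t\<bar> < 1"
    using tendstoD[OF lim(1), of 1] by (simp add: dist_real_def)
  moreover have "\<forall>\<^sub>F w in at z. \<bar>snd w - s\<bar> < d"
    using tendstoD[OF lim(2) d] by (simp add: dist_real_def)
  ultimately show "\<forall>\<^sub>F w in at z. p ((case w of (t, s) \<Rightarrow> path_deriv k (c s) t) -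
      (case z of (t, s) \<Rightarrow> path_deriv k (c s) t)) < e"
  proof eventually_elim
    case (elim w)
    show ?case
      using elim(1) near_s[OF elim(3,2)] cont_seminorm_diff_triangle[OF p,
          of "path_deriv k (c (snd w)) (fst w)" "path_deriv k (c s) t" "path_deriv k (c s) (fst w)"]
      by (simp add: z case_prod_beta)
  qed
qed

text \<open>The partial derivatives of \<open>(t, s) \<mapsto> path_deriv i (D j s) t\<close> arise by raising \<open>i\<close> and
\<open>j\<close> by one, so that all these functions are of every class by simultaneous induction.\<close>

lemma smooth2_path_eval:
  fixes c :: "real \<Rightarrow> 'a::frechet_space smooth_path"
  assumes "smooth_curve c"
  shows "smooth2 (\<lambda>(t, s). path_at (c s) t)"
proof -
  obtain D where D: "D 0 = c" "\<And>k t. has_curve_derivative (D k) (D (Suc k) t) t"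
    using assms unfolding smooth_curve_def by blast
  have "Ck k (\<lambda>(t, s). path_deriv i (D j s) t)" for k i j
  proof (induction k arbitrary: i j)
    case (Suc k)
    show ?case
      by (rule Ck_SucI[OF continuous_path_eval[OF D(2)] Suc.IH[of "Suc i" j] Suc.IH[of i "Suc j"]])
         (simp_all add: has_curve_derivative_path_deriv has_curve_derivative_path_eval[OF D(2)])
  qed (simp add: continuous_path_eval[OF D(2)])
  from this[of _ 0 0] show ?thesis
    by (simp add: smooth2_def D(1) path_deriv_0)
qed

section \<open>The coefficients of the solution\<close>

text \<open>The iterated integrals, oriented for negative times. The integral in the recursion is a
\<open>primitive\<close> at a fixed parameter.\<close>

primrec lax_coeff :: "real \<Rightarrow> 'a::frechet_algebra_1 smooth_path \<Rightarrow> 'a \<Rightarrow> nat \<Rightarrow> real \<Rightarrow> 'a" where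
  "lax_coeff q P a 0 t = a"
| "lax_coeff q P a (Suc n) t = t *\<^sub>R unit_integral (\<lambda>x.
     path_at P (q * (x * t)) * lax_coeff q P a n (x * t) -
     lax_coeff q P a n (x * t) * path_at P (q * (x * t)))"

lemma bilinear_times: "bilinear ((*) :: 'a::real_algebra \<Rightarrow> 'a \<Rightarrow> 'a)"
  by (auto simp: bilinear_def linear_iff algebra_simps)

lemma continuous_times_joint: "continuous_on UNIV (\<lambda>(x, y). x * y :: 'a::frechet_algebra_1)"
  unfolding continuous_on_def case_prod_beta
  by (intro ballI tendsto_mult[OF tendsto_fst[OF tendsto_ident_at] tendsto_snd[OF tendsto_ident_at]])

definition bracket_integrand ::
  "(real \<Rightarrow> real) \<Rightarrow> (real \<Rightarrow> 'a::frechet_algebra_1 smooth_path) \<Rightarrow> (real \<Rightarrow> 'a) \<Rightarrow> nat \<Rightarrow> real \<times> real \<Rightarrow> 'a" where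
  "bracket_integrand q P a n = (\<lambda>(t, s).
     path_at (P s) (q s * t) * lax_coeff (q s) (P s) (a s) n t -
     lax_coeff (q s) (P s) (a s) n t * path_at (P s) (q s * t))"

lemma lax_coeff_Suc_primitive:
  "(\<lambda>(t, s). lax_coeff (q s) (P s) (a s) (Suc n) t) = primitive (bracket_integrand q P a n)"
  by (simp add: primitive_def bracket_integrand_def fun_eq_iff)

text \<open>Induction on \<open>n\<close>: the path is evaluated at \<open>q s * t\<close> by substitution into a jointly
smooth function, the bracket is a difference of bilinear terms, and the next coefficient is a
primitive of the bracket.\<close>

lemma smooth2_lax_coeff:
  assumes q: "smooth_curve q" and P: "smooth_curve P" and a: "smooth_curve a"
  shows "smooth2 (\<lambda>(t, s). lax_coeff (q s) (P s) (a s) n t)"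
    and "smooth2 (bracket_integrand q P a n)"
proof -
  have "Ck k (\<lambda>z. q (snd z) *\<^sub>R fst z)" for k
    using smooth2_curve[OF q] by (intro Ck_scaleR Ck_fst) (simp add: smooth2_def)
  then have "Ck k (\<lambda>z. (\<lambda>(t, s). path_at (P s) t) (q (snd z) *\<^sub>R fst z, snd z))" for k
    using smooth2_path_eval[OF P] Ck_snd by (intro Ck_compose) (simp_all add: smooth2_def)
  then have path: "Ck k (\<lambda>(t, s). path_at (P s) (q s * t))" for k
    by (simp add: case_prod_unfold)
  have bracket: "Ck k (bracket_integrand q P a n)"
    if "Ck k (\<lambda>(t, s). lax_coeff (q s) (P s) (a s) n t)" for k n
  proof -
    note B = Ck_bilinear[OF bilinear_times continuous_times_joint]
    \<comment> \<open>the subtracted product as a scalar multiple, to fit closure under sums\<close>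
    have "Ck k (\<lambda>z. (-1) *\<^sub>R ((\<lambda>(t, s). lax_coeff (q s) (P s) (a s) n t) z * (\<lambda>(t, s). path_at (P s) (q s * t)) z))"
      by (intro Ck_scaleR Ck_const B that path)
    from Ck_add[OF B[OF path that] this] show ?thesis
      by (simp add: bracket_integrand_def case_prod_unfold)
  qed
  have coeff: "Ck k (\<lambda>(t, s). lax_coeff (q s) (P s) (a s) n t)" for k n
  proof (induction n)
    case 0
    then show ?case using smooth2_curve[OF a] by (simp add: smooth2_def case_prod_beta)
  next
    case (Suc n)
    show ?case unfolding lax_coeff_Suc_primitive by (intro Ck_primitive bracket Suc)
  qed
  show "smooth2 (\<lambda>(t, s). lax_coeff (q s) (P s) (a s) n t)"
    and "smooth2 (bracket_integrand q P a n)"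
    unfolding smooth2_def using coeff bracket by blast+
qed

text \<open>Constant curves of data reduce this to the time derivative of a primitive. Joint smoothness
makes the integrand continuously differentiable in time, as that derivative requires.\<close>

lemma lax_coeff_derivative:
  "has_curve_derivative (lax_coeff q P a (Suc n))
     (path_at P (q * t) * lax_coeff q P a n t - lax_coeff q P a n t * path_at P (q * t)) t"
proof -
  have "smooth2 (bracket_integrand (\<lambda>_. q) (\<lambda>_. P) (\<lambda>_. a) n)"
    by (intro smooth2_lax_coeff smooth_curve_const)
  then have "Ck 1 (bracket_integrand (\<lambda>_. q) (\<lambda>_. P) (\<lambda>_. a) n)"
    unfolding smooth2_def by blast
  then obtain f1 f2 where f: "continuous_on UNIV (bracket_integrand (\<lambda>_. q) (\<lambda>_. P) (\<lambda>_. a) n)"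
    "Ck 0 f1" "Ck 0 f2"
    "\<And>x y. has_curve_derivative (\<lambda>x. bracket_integrand (\<lambda>_. q) (\<lambda>_. P) (\<lambda>_. a) n (x, y)) (f1 (x, y)) x"
    "\<And>x y. has_curve_derivative (\<lambda>y. bracket_integrand (\<lambda>_. q) (\<lambda>_. P) (\<lambda>_. a) n (x, y)) (f2 (x, y)) y"
    unfolding One_nat_def by (rule Ck_SucE) blast
  from primitive_derivative_time[OF f(1) Ck_continuous[OF f(2)] f(4), of 0 t]
  show ?thesis
    unfolding lax_coeff_Suc_primitive[symmetric] by (simp only: bracket_integrand_def prod.case)
qed

text \<open>Multiplication by a monomial of degree one shifts coefficients, as sums with a single
nonzero term show. Evaluating the convolution sums directly covers the zero algebra too.\<close>

lemma scaled_path_bracket_nth: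
  "fps_nth (scaled_path q P t * L - L * scaled_path q P t) n =
     (case n of 0 \<Rightarrow> 0
      | Suc m \<Rightarrow> path_at P (q * t) * fps_nth L m - fps_nth L m * path_at P (q * t))"
proof -
  have scaled: "fps_nth (scaled_path q P t) i = (if i = 1 then path_at P (q * t) else 0)" for i
  proof -
    have "fps_nth (scaled_path q P t) i =
        (\<Sum>j\<in>{0..i}. (if j = i then (if i = 1 then path_at P (q * t) else 0) else 0))"
      unfolding scaled_path_def fps_mult_nth by (intro sum.cong) (auto simp: fps_X_def)
    then show ?thesis by simp
  qed
  have "fps_nth (scaled_path q P t * L) n =
      (\<Sum>i\<in>{0..n}. if i = 1 then path_at P (q * t) * fps_nth L (n - 1) else 0)"
    unfolding fps_mult_nth scaled by (intro sum.cong) auto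
  moreover have "fps_nth (L * scaled_path q P t) n =
      (\<Sum>i\<in>{0..n}. if i = n - 1 \<and> n \<noteq> 0 then fps_nth L (n - 1) * path_at P (q * t) else 0)"
    unfolding fps_mult_nth scaled by (intro sum.cong) auto
  ultimately show ?thesis
    by (cases n) auto
qed

text \<open>Comparing coefficients turns the equation into the recursion of \<open>lax_coeff\<close>: two
coefficients of degree \<open>n + 1\<close> that satisfy it have equal derivatives, once the coefficients of
degree \<open>n\<close> agree, and both vanish at time \<open>0\<close>.\<close>

lemma lax_solution_iff:
  "lax_solution q P a L \<longleftrightarrow> L = (\<lambda>t. Abs_fps (\<lambda>n. lax_coeff q P a n t))"
proof
  assume L: "lax_solution q P a L"
  have init: "fps_nth (L 0) n = (if n = 0 then a else 0)" for n
    using L by (simp add: lax_solution_def)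
  have deriv: "has_curve_derivative (\<lambda>t. fps_nth (L t) n)
      (case n of 0 \<Rightarrow> 0
        | Suc m \<Rightarrow> path_at P (q * t) * fps_nth (L t) m - fps_nth (L t) m * path_at P (q * t)) t" for n t
    using L unfolding lax_solution_def has_fps_derivative_def scaled_path_bracket_nth by blast
  have "fps_nth (L t) n = lax_coeff q P a n t" for n t
  proof (induction n arbitrary: t)
    case 0
    show ?case
      using has_curve_derivative_zero_const[of "\<lambda>t. fps_nth (L t) 0" t 0] deriv[of 0] init by simp
  next
    case (Suc n)
    define c where "c t = fps_nth (L t) (Suc n) + (-1) *\<^sub>R lax_coeff q P a (Suc n) t" for t
    let ?b = "\<lambda>t. path_at P (q * t) * lax_coeff q P a n t - lax_coeff q P a n t * path_at P (q * t)"
    have "has_curve_derivative c (?b t + (0 *\<^sub>R lax_coeff q P a (Suc n) t + (-1) *\<^sub>R ?b t)) t" for t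
      unfolding c_def
      by (intro has_curve_derivative_add has_curve_derivative_scaleR has_curve_derivative_const
          lax_coeff_derivative) (use deriv[of "Suc n"] Suc in simp)
    then have "c t = c 0"
      by (intro has_curve_derivative_zero_const) simp
    then show ?case by (simp add: c_def init)
  qed
  then show "L = (\<lambda>t. Abs_fps (\<lambda>n. lax_coeff q P a n t))"
    by (intro ext fps_ext) simp
next
  assume L: "L = (\<lambda>t. Abs_fps (\<lambda>n. lax_coeff q P a n t))"
  have "has_curve_derivative (\<lambda>t. fps_nth (L t) n)
      (case n of 0 \<Rightarrow> 0
        | Suc m \<Rightarrow> path_at P (q * t) * fps_nth (L t) m - fps_nth (L t) m * path_at P (q * t)) t"
    for n t
  proof (cases n)
    case 0
    then show ?thesis by (simp add: L has_curve_derivative_const)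
  next
    case (Suc m)
    then show ?thesis using lax_coeff_derivative[of q P a m t] by (simp add: L del: lax_coeff.simps)
  qed
  moreover have "L 0 = fps_const a"
  proof (rule fps_ext)
    fix n show "fps_nth (L 0) n = fps_nth (fps_const a) n"
      by (cases n) (simp_all add: L)
  qed
  ultimately show "lax_solution q P a L"
    by (simp add: lax_solution_def has_fps_derivative_def scaled_path_bracket_nth del: fps_sub_nth)
qed

lemma smooth_curve_fst:
  assumes "smooth_curve (c :: real \<Rightarrow> 'v::{real_vector, topological_space} \<times> 'w::{real_vector, topological_space})"
  shows "smooth_curve (\<lambda>s. fst (c s))"
proof -
  obtain D where D: "D 0 = c" "\<And>k t. has_curve_derivative (D k) (D (Suc k) t) t"
    using assms unfolding smooth_curve_def by blast
  show ?thesis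
    unfolding smooth_curve_def
    using D(1) tendsto_fst[OF D(2)[unfolded has_curve_derivative_def]]
    by (intro exI[of _ "\<lambda>k t. fst (D k t)"]) (simp add: has_curve_derivative_def)
qed

lemma smooth_curve_snd:
  assumes "smooth_curve (c :: real \<Rightarrow> 'v::{real_vector, topological_space} \<times> 'w::{real_vector, topological_space})"
  shows "smooth_curve (\<lambda>s. snd (c s))"
proof -
  obtain D where D: "D 0 = c" "\<And>k t. has_curve_derivative (D k) (D (Suc k) t) t"
    using assms unfolding smooth_curve_def by blast
  show ?thesis
    unfolding smooth_curve_def
    using D(1) tendsto_snd[OF D(2)[unfolded has_curve_derivative_def]]
    by (intro exI[of _ "\<lambda>k t. snd (D k t)"]) (simp add: has_curve_derivative_def)
qed

section \<open>Existence, uniqueness and smooth dependence\<close>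

theorem theorem2p3:
  shows "(\<forall>(q::real) (P :: 'a::frechet_algebra_1 smooth_path) (a::'a).
            \<exists>!L. lax_solution q P a L) \<and>
         frolicher_smooth
           (frechet_curves :: (real \<Rightarrow> real \<times> real \<times> 'a smooth_path \<times> 'a) set)
           fps_curves
           (\<lambda>(t, q, P, a). (THE L. lax_solution q P a L) t)"
proof
  show "\<forall>(q::real) (P :: 'a smooth_path) (a::'a). \<exists>!L. lax_solution q P a L"
    by (simp add: lax_solution_iff)
  show "frolicher_smooth
      (frechet_curves :: (real \<Rightarrow> real \<times> real \<times> 'a smooth_path \<times> 'a) set) fps_curves
      (\<lambda>(t, q, P, a). (THE L. lax_solution q P a L) t)"
    unfolding frolicher_smooth_def fps_curves_def frechet_curves_def mem_Collect_eq
  proof (intro ballI allI)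
    fix c :: "real \<Rightarrow> real \<times> real \<times> 'a smooth_path \<times> 'a" and n
    assume "c \<in> {c. smooth_curve c}"
    then have c: "smooth_curve c" by simp
    define t where "t s = fst (c s)" for s
    define q where "q s = fst (snd (c s))" for s
    define P where "P s = fst (snd (snd (c s)))" for s
    define a where "a s = snd (snd (snd (c s)))" for s
    have t: "smooth_curve t" and q: "smooth_curve q" and P: "smooth_curve P" and a: "smooth_curve a"
      unfolding t_def q_def P_def a_def by (intro smooth_curve_fst smooth_curve_snd c)+
    have "Ck k (\<lambda>z. (\<lambda>(t, s). lax_coeff (q s) (P s) (a s) n t) (t (snd z), snd z))" for k
      using smooth2_lax_coeff(1)[OF q P a] smooth2_curve[OF t] Ck_snd
      by (intro Ck_compose) (simp_all add: smooth2_def)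
    then have "smooth2 (\<lambda>z. lax_coeff (q (snd z)) (P (snd z)) (a (snd z)) n (t (snd z)))"
      by (simp add: smooth2_def)
    from smooth2_smooth_curve[OF this]
    have "smooth_curve (\<lambda>s. lax_coeff (q s) (P s) (a s) n (t s))" by simp
    then show "smooth_curve (\<lambda>s. fps_nth (((\<lambda>(t, q, P, a). (THE L. lax_solution q P a L) t) \<circ> c) s) n)"
      by (simp add: lax_solution_iff case_prod_beta t_def q_def P_def a_def)
  qed
qed

end
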